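(* Let $P$ be a Poisson manifold with Poisson tensor $\Pi$ and bracket $\{\cdot,\cdot\}$, let $H_0$ be a smooth function on $P$ with values in complex $N\times N$ matrices, and let $\lambda$ be a regular eigenvalue function for $H_0$ with associated projection $\pi_0$ onto the eigenbundle $E_\lambda$. Then the matrix-valued function $$\Lambda_C=\pi_0\{\pi_0,H_0-\lambda I\}\pi_0,$$ regarded as an endomorphism of $E_\lambda$, is given by $$\Lambda_C=\lambda\,\langle\Pi,F\rangle-\bigl\langle\Pi,\;S^*\wedge\bigl((H_0-\lambda\pi_0)S\bigr)\bigr\rangle ,$$ where $F$ is the curvature of the projected connection $D$ on $E_\lambda$, and $S$ and $S^*$ are the second-fundamental-form-type $1$-forms associated with $\pi_0$ (all defined in the context).
   Context: A smooth scalar function $\lambda$ on $P$ is a regular eigenvalue function for $H_0$ if $\lambda(x)$ is an eigenvalue of $H_0(x)$ with multiplicity independent of $x$, and for every $x$ the null space and range of $H_0(x)-\lambda(x)I$ are complementary subspaces of $\mathbb C^N$. $\pi_0(x)$ denotes the projection onto the null space of $H_0(x)-\lambda(x)I$ along its range (it is smooth in $x$); $E_\lambda$ is the vector bundle over $P$ of images of the $\pi_0(x)$, and $E_\lambda^\perp$ is the bundle of null spaces of the $\pi_0(x)$; both are subbundles of the trivial bundle $P\times\mathbb C^N$, on which $d$ denotes the trivial connection. The Poisson bracket of matrix-valued functions is $\{a,b\}_{ij}=\sum_k\{a_{ik},b_{kj}\}$. Wedge products of matrix- (or endomorphism/homomorphism-)valued forms combine the wedge product of forms with composition. $\langle\Pi,\cdot\rangle$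 denotes contraction of (endomorphism-valued) $2$-forms with the Poisson tensor, normalized so that $\langle\Pi,da\wedge db\rangle=\{a,b\}$. The projected connection on $E_\lambda$ is $D\zeta=\pi_0\,d\zeta$ for sections $\zeta$ of $E_\lambda$; extending $D$ to a covariant exterior derivative, its curvature $F$ is the $2$-form with values in endomorphisms of $E_\lambda$ defined by $D^2\zeta=F\zeta$. $S$ is the $1$-form with values in homomorphisms $E_\lambda\to E_\lambda^\perp$ given by $S\zeta=(I-\pi_0)\,d\zeta$ for sections $\zeta$ of $E_\lambda$. $S^*$ is the $1$-form with values in homomorphisms $E_\lambda^\perp\to E_\lambda$ given by $S^*\eta=-\pi_0\,d\eta$ for sections $\eta$ of $E_\lambda^\perp$. In the formula, $H_0-\lambda\pi_0$ is considered as an endomorphism of $E_\lambda^\perp$. *)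

theory Defs
  imports "HOL-Analysis.Analysis"
begin

section \<open>Smooth functions on open subsets of Euclidean space\<close>

text \<open>For open \<open>S\<close> in a Euclidean space, \<open>k_smooth_on k S f\<close> is equivalent to \<open>f\<close> being of class
  \<open>C\<^sup>k\<close> on \<open>S\<close>: all iterated directional derivatives up to order \<open>k\<close> exist and are continuous.\<close>

primrec k_smooth_on ::
    "nat \<Rightarrow> 'e::euclidean_space set \<Rightarrow> ('e \<Rightarrow> 'v::real_normed_vector) \<Rightarrow> bool" where
  "k_smooth_on 0 S f \<longleftrightarrow> continuous_on S f"
| "k_smooth_on (Suc k) S f \<longleftrightarrow>
     (\<forall>x\<in>S. f differentiable (at x)) \<and>
     (\<forall>h. k_smooth_on k S (\<lambda>x. frechet_derivative f (at x) h))"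

definition smooth_on :: "'e::euclidean_space set \<Rightarrow> ('e \<Rightarrow> 'v::real_normed_vector) \<Rightarrow> bool" where
  "smooth_on S f \<longleftrightarrow> (\<forall>k. k_smooth_on k S f)"


section \<open>Smooth manifolds\<close>

text \<open>A chart is a pair of a domain and a coordinate map; the values of the coordinate map
  outside the domain are irrelevant. Manifolds are given by an abstract topology \<open>X\<close>
  (so that the point set is a set, not a whole type) and a smooth, not necessarily maximal, atlas
  \<open>A\<close>. The dimension is \<open>DIM('e)\<close>.\<close>

type_synonym ('p, 'e) chart = "'p set \<times> ('p \<Rightarrow> 'e)"

definition chart_inv :: "('p, 'e) chart \<Rightarrow> 'e \<Rightarrow> 'p" where
  "chart_inv c = inv_into (fst c) (snd c)"

definition is_chart :: "'p topology \<Rightarrow> ('p, 'e::euclidean_space) chart \<Rightarrow> bool" where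
  "is_chart X c \<longleftrightarrow> openin X (fst c) \<and> open (snd c ` fst c) \<and>
     homeomorphic_map (subtopology X (fst c)) (top_of_set (snd c ` fst c)) (snd c)"

definition transition :: "('p, 'e) chart \<Rightarrow> ('p, 'e) chart \<Rightarrow> 'e \<Rightarrow> 'e" where
  "transition c c' = snd c' \<circ> chart_inv c"

definition smooth_manifold ::
    "'p topology \<Rightarrow> ('p, 'e::euclidean_space) chart set \<Rightarrow> bool" where
  "smooth_manifold X A \<longleftrightarrow>
     Hausdorff_space X \<and> second_countable X \<and>
     (\<forall>c\<in>A. is_chart X c) \<and> (\<Union>c\<in>A. fst c) = topspace X \<and>
     (\<forall>c\<in>A. \<forall>c'\<in>A. smooth_on (snd c ` (fst c \<inter> fst c')) (transition c c'))"

definition smooth_map ::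
    "('p, 'e::euclidean_space) chart set \<Rightarrow> ('p \<Rightarrow> 'v::real_normed_vector) \<Rightarrow> bool" where
  "smooth_map A f \<longleftrightarrow> (\<forall>c\<in>A. smooth_on (snd c ` fst c) (f \<circ> chart_inv c))"

text \<open>Quantities that are independent of the chart are evaluated at \<open>p\<close> in some chart around \<open>p\<close>.\<close>

definition chart_at :: "('p, 'e) chart set \<Rightarrow> 'p \<Rightarrow> ('p, 'e) chart" where
  "chart_at A p = (SOME c. c \<in> A \<and> p \<in> fst c)"


lemma chart_inv_left:
  assumes "smooth_manifold X A" "c \<in> A" "p \<in> fst c"
  shows "chart_inv c (snd c p) = p"
proof -
  have "openin X (fst c)" and hm: "homeomorphic_map (subtopology X (fst c)) (top_of_set (snd c ` fst c)) (snd c)"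
    using assms by (auto simp: smooth_manifold_def is_chart_def)
  then have "topspace (subtopology X (fst c)) = fst c"
    using openin_subset by (fastforce simp: topspace_subtopology)
  then have "inj_on (snd c) (fst c)"
    using hm by (metis homeomorphic_imp_injective_map)
  then show ?thesis
    using assms by (simp add: chart_inv_def)
qed

lemma open_chart_image_Int:
  assumes M: "smooth_manifold X A" and "c \<in> A" "c' \<in> A"
  shows "open (snd c ` (fst c \<inter> fst c'))"
proof -
  let ?Y = "subtopology X (fst c)"
  have c: "openin X (fst c)" "open (snd c ` fst c)"
    "homeomorphic_map ?Y (top_of_set (snd c ` fst c)) (snd c)" and c': "openin X (fst c')"
    using assms by (auto simp: smooth_manifold_def is_chart_def)
  have "openin ?Y (fst c \<inter> fst c')"
    using c(1) c' by (simp add: openin_open_subtopology openin_Int)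
  then have "openin (top_of_set (snd c ` fst c)) (snd c ` (fst c \<inter> fst c'))"
    using c(3) homeomorphic_imp_open_map open_map_def by blast
  then show ?thesis
    using c(2) openin_open_trans by blast
qed

lemma transition_differentiable:
  assumes M: "smooth_manifold X A" and "c \<in> A" "c' \<in> A" "p \<in> fst c" "p \<in> fst c'"
  shows "transition c c' differentiable (at (snd c p))"
proof -
  have "k_smooth_on (Suc 0) (snd c ` (fst c \<inter> fst c')) (transition c c')"
    using assms unfolding smooth_manifold_def smooth_on_def by blast
  then show ?thesis
    using assms by auto
qed

lemma smooth_map_differentiable:
  assumes "smooth_map A f" "c \<in> A" "p \<in> fst c"
  shows "(f \<circ> chart_inv c) differentiable (at (snd c p))"
proof -
  have "k_smooth_on (Suc 0) (snd c ` fst c) (f \<circ> chart_inv c)"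
    using assms unfolding smooth_map_def smooth_on_def by blast
  then show ?thesis
    using assms by auto
qed


section \<open>Differential forms\<close>

text \<open>A form is represented by its local expressions: \<open>\<omega> c p h\<close> (resp. \<open>\<omega> c p h k\<close>) is the value at
  the point \<open>p\<close> in the domain of the chart \<open>c\<close> on the tangent vectors whose components with
  respect to \<open>c\<close> are \<open>h\<close> and \<open>k\<close>. For fixed \<open>c\<close> and \<open>h\<close>, the function \<open>\<lambda>p. \<alpha> c p h\<close> is the value of
  the 1-form \<open>\<alpha>\<close> on the coordinate vector field of \<open>c\<close> with constant components \<open>h\<close>.\<close>

type_synonym ('p, 'e, 'v) form1 = "('p, 'e) chart \<Rightarrow> 'p \<Rightarrow> 'e \<Rightarrow> 'v"
type_synonym ('p, 'e, 'v) form2 = "('p, 'e) chart \<Rightarrow> 'p \<Rightarrow> 'e \<Rightarrow> 'e \<Rightarrow> 'v"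

definition differential ::
    "('p \<Rightarrow> 'v::real_normed_vector) \<Rightarrow> ('p, 'e::euclidean_space, 'v) form1" where
  "differential f c p h = frechet_derivative (f \<circ> chart_inv c) (at (snd c p)) h"

lemma differential_linear:
  assumes "smooth_map A f" "c \<in> A" "p \<in> fst c"
  shows "linear (differential f c p)"
  using linear_frechet_derivative[OF smooth_map_differentiable[OF assms]]
  by (simp add: differential_def[abs_def])

lemma differential_transition:
  assumes M: "smooth_manifold X A" and f: "smooth_map A f"
    and c: "c \<in> A" "c' \<in> A" "p \<in> fst c" "p \<in> fst c'"
  shows "differential f c p h =
    differential f c' p (frechet_derivative (transition c c') (at (snd c p)) h)"
proof -
  let ?T = "transition c c'" and ?y = "snd c p"
  have y': "?T ?y = snd c' p"
    by (simp add: transition_def chart_inv_left[OF M c(1,3)])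
  have T: "(?T has_derivative frechet_derivative ?T (at ?y)) (at ?y)"
    using transition_differentiable[OF M c] by (simp add: frechet_derivative_works)
  have "((f \<circ> chart_inv c') has_derivative frechet_derivative (f \<circ> chart_inv c') (at (snd c' p)))
      (at (?T ?y))"
    using smooth_map_differentiable[OF f c(2,4)] y' by (simp add: frechet_derivative_works)
  from diff_chain_at[OF T this]
  have D: "((f \<circ> chart_inv c' \<circ> ?T) has_derivative
      (\<lambda>h. differential f c' p (frechet_derivative ?T (at ?y) h))) (at ?y)"
    by (simp add: o_def differential_def)
  have "((f \<circ> chart_inv c) has_derivative
      (\<lambda>h. differential f c' p (frechet_derivative ?T (at ?y) h))) (at ?y)"
  proof (rule has_derivative_transform_within_open[OF D open_chart_image_Int[OF M c(1,2)]])
    show "?y \<in> snd c ` (fst c \<inter> fst c')" using c by auto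
    fix z assume "z \<in> snd c ` (fst c \<inter> fst c')"
    then obtain q where "q \<in> fst c" "q \<in> fst c'" "z = snd c q" by auto
    then show "(f \<circ> chart_inv c' \<circ> ?T) z = (f \<circ> chart_inv c) z"
      by (simp add: transition_def chart_inv_left[OF M] c)
  qed
  then have "(\<lambda>h. differential f c' p (frechet_derivative ?T (at ?y) h)) =
      frechet_derivative (f \<circ> chart_inv c) (at ?y)"
    by (rule frechet_derivative_at)
  then show ?thesis
    by (metis differential_def)
qed

definition wedge ::
    "('p, 'e, complex^'N^'N) form1 \<Rightarrow> ('p, 'e, complex^'N^'N) form1 \<Rightarrow>
     ('p, 'e, complex^'N^'N) form2" where
  "wedge \<alpha> \<beta> c p h k = \<alpha> c p h ** \<beta> c p k - \<alpha> c p k ** \<beta> c p h"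


section \<open>Poisson manifolds\<close>

text \<open>A bivector field is given by its components \<open>\<Pi>\<^sub>P c p i j\<close>, \<open>i, j \<in> Basis\<close>, in the charts \<open>c\<close>.\<close>

type_synonym ('p, 'e) bivector = "('p, 'e) chart \<Rightarrow> 'p \<Rightarrow> 'e \<Rightarrow> 'e \<Rightarrow> real"

definition bivector_field ::
    "('p, 'e::euclidean_space) chart set \<Rightarrow> ('p, 'e) bivector \<Rightarrow> bool" where
  "bivector_field A \<Pi>\<^sub>P \<longleftrightarrow>
     (\<forall>c\<in>A. \<forall>i\<in>Basis. \<forall>j\<in>Basis.
        smooth_on (snd c ` fst c) (\<lambda>y. \<Pi>\<^sub>P c (chart_inv c y) i j) \<and>
        (\<forall>p\<in>fst c. \<Pi>\<^sub>P c p j i = - \<Pi>\<^sub>P c p i j)) \<and>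
     (\<forall>c\<in>A. \<forall>c'\<in>A. \<forall>p\<in>fst c \<inter> fst c'. \<forall>i\<in>Basis. \<forall>j\<in>Basis.
        \<Pi>\<^sub>P c' p i j = (\<Sum>k\<in>Basis. \<Sum>l\<in>Basis.
          (frechet_derivative (transition c c') (at (snd c p)) k \<bullet> i) *
          (frechet_derivative (transition c c') (at (snd c p)) l \<bullet> j) * \<Pi>\<^sub>P c p k l))"

text \<open>The bracket \<open>\<Pi>\<^sub>P(df, dg)\<close>; for complex-valued functions it is extended complex bilinearly.\<close>

definition poisson_bracket ::
    "('p, 'e::euclidean_space) chart set \<Rightarrow> ('p, 'e) bivector \<Rightarrow>
     ('p \<Rightarrow> 'a::real_normed_field) \<Rightarrow> ('p \<Rightarrow> 'a) \<Rightarrow> 'p \<Rightarrow> 'a" where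
  "poisson_bracket A \<Pi>\<^sub>P f g p = (let c = chart_at A p in
     \<Sum>i\<in>Basis. \<Sum>j\<in>Basis. \<Pi>\<^sub>P c p i j *\<^sub>R (differential f c p i * differential g c p j))"

text \<open>The choice of the chart in the definition of the bracket does not matter.\<close>

lemma poisson_bracket_chart:
  assumes M: "smooth_manifold X A" and B: "bivector_field A \<Pi>\<^sub>P"
    and f: "smooth_map A f" and g: "smooth_map A g" and c: "c \<in> A" "p \<in> fst c"
  shows "poisson_bracket A \<Pi>\<^sub>P f g p =
    (\<Sum>i\<in>Basis. \<Sum>j\<in>Basis. \<Pi>\<^sub>P c p i j *\<^sub>R (differential f c p i * differential g c p j))"
proof -
  define c' where "c' = chart_at A p"
  have c': "c' \<in> A" "p \<in> fst c'"
    using someI[of "\<lambda>c. c \<in> A \<and> p \<in> fst c" c] c by (auto simp: c'_def chart_at_def)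
  define T where "T = frechet_derivative (transition c c') (at (snd c p))"
  have ex: "differential u c p k = (\<Sum>i\<in>Basis. (T k \<bullet> i) *\<^sub>R differential u c' p i)"
    if "smooth_map A u" for u and k
  proof -
    have l: "linear (differential u c' p)" by (rule differential_linear[OF that c'])
    have "differential u c p k = differential u c' p (\<Sum>i\<in>Basis. (T k \<bullet> i) *\<^sub>R i)"
      using differential_transition[OF M that c(1) c'(1) c(2) c'(2), of k]
      by (simp add: T_def euclidean_representation)
    also have "\<dots> = (\<Sum>i\<in>Basis. (T k \<bullet> i) *\<^sub>R differential u c' p i)"
      by (simp only: linear_sum[OF l] linear_scale[OF l])
    finally show ?thesis .
  qed
  have tr: "\<Pi>\<^sub>P c' p i j =
      (\<Sum>k\<in>Basis. \<Sum>l\<in>Basis. (T k \<bullet> i) * (T l \<bullet> j) * \<Pi>\<^sub>P c p k l)"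
    if "i \<in> Basis" "j \<in> Basis" for i j
    using B c c' that unfolding bivector_field_def T_def by blast
  let ?t = "\<lambda>i j k l. ((T k \<bullet> i) * (T l \<bullet> j) * \<Pi>\<^sub>P c p k l) *\<^sub>R
      (differential f c' p i * differential g c' p j)"
  have "poisson_bracket A \<Pi>\<^sub>P f g p =
      (\<Sum>i\<in>Basis. \<Sum>j\<in>Basis. \<Sum>k\<in>Basis. \<Sum>l\<in>Basis. ?t i j k l)"
    by (simp add: poisson_bracket_def Let_def c'_def[symmetric] tr scaleR_sum_left)
  also have "\<dots> = (\<Sum>i\<in>Basis. \<Sum>k\<in>Basis. \<Sum>j\<in>Basis. \<Sum>l\<in>Basis. ?t i j k l)"
    by (intro sum.cong refl sum.swap)
  also have "\<dots> = (\<Sum>k\<in>Basis. \<Sum>i\<in>Basis. \<Sum>j\<in>Basis. \<Sum>l\<in>Basis. ?t i j k l)"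
    by (rule sum.swap)
  also have "\<dots> = (\<Sum>k\<in>Basis. \<Sum>i\<in>Basis. \<Sum>l\<in>Basis. \<Sum>j\<in>Basis. ?t i j k l)"
    by (intro sum.cong refl sum.swap)
  also have "\<dots> = (\<Sum>k\<in>Basis. \<Sum>l\<in>Basis. \<Sum>i\<in>Basis. \<Sum>j\<in>Basis. ?t i j k l)"
    by (intro sum.cong refl sum.swap)
  also have "\<dots> = (\<Sum>k\<in>Basis. \<Sum>l\<in>Basis.
      \<Pi>\<^sub>P c p k l *\<^sub>R (differential f c p k * differential g c p l))"
    by (intro sum.cong refl)
      (simp add: ex[OF f] ex[OF g] sum_product scaleR_sum_right mult_ac)
  finally show ?thesis .
qed

definition poisson_manifold ::
    "'p topology \<Rightarrow> ('p, 'e::euclidean_space) chart set \<Rightarrow> ('p, 'e) bivector \<Rightarrow> bool" where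
  "poisson_manifold X A \<Pi>\<^sub>P \<longleftrightarrow>
     smooth_manifold X A \<and> bivector_field A \<Pi>\<^sub>P \<and>
     (\<forall>f g h :: 'p \<Rightarrow> real. smooth_map A f \<longrightarrow> smooth_map A g \<longrightarrow> smooth_map A h \<longrightarrow>
        (\<forall>p\<in>topspace X.
           poisson_bracket A \<Pi>\<^sub>P f (poisson_bracket A \<Pi>\<^sub>P g h) p +
           poisson_bracket A \<Pi>\<^sub>P g (poisson_bracket A \<Pi>\<^sub>P h f) p +
           poisson_bracket A \<Pi>\<^sub>P h (poisson_bracket A \<Pi>\<^sub>P f g) p = 0))"

definition matrix_bracket ::
    "('p, 'e::euclidean_space) chart set \<Rightarrow> ('p, 'e) bivector \<Rightarrow>
     ('p \<Rightarrow> complex^'N^'N) \<Rightarrow> ('p \<Rightarrow> complex^'N^'N) \<Rightarrow> 'p \<Rightarrow> complex^'N^'N" where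
  "matrix_bracket A \<Pi>\<^sub>P a b p =
     (\<chi> i j. \<Sum>k\<in>UNIV. poisson_bracket A \<Pi>\<^sub>P (\<lambda>q. a q $ i $ k) (\<lambda>q. b q $ k $ j) p)"

text \<open>The factor \<open>1/2\<close> is the normalization under which contracting \<open>da \<and> db\<close> gives \<open>{a, b}\<close>, where
  \<open>(da \<and> db)(h, k) = da(h) db(k) - da(k) db(h)\<close>.\<close>

definition contraction ::
    "('p, 'e::euclidean_space) chart set \<Rightarrow> ('p, 'e) bivector \<Rightarrow>
     ('p, 'e, 'v::real_vector) form2 \<Rightarrow> 'p \<Rightarrow> 'v" where
  "contraction A \<Pi>\<^sub>P \<omega> p = (let c = chart_at A p in
     (1/2) *\<^sub>R (\<Sum>i\<in>Basis. \<Sum>j\<in>Basis. \<Pi>\<^sub>P c p i j *\<^sub>R \<omega> c p i j))"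

lemma contraction_wedge:
  fixes \<Pi>\<^sub>P :: "('p, 'e::euclidean_space) bivector"
  assumes B: "bivector_field A \<Pi>\<^sub>P" and p: "c \<in> A" "p \<in> fst c"
  shows "contraction A \<Pi>\<^sub>P (wedge \<alpha> \<beta>) p = (let c = chart_at A p in
    \<Sum>i\<in>Basis. \<Sum>j\<in>Basis. \<Pi>\<^sub>P c p i j *\<^sub>R (\<alpha> c p i ** \<beta> c p j))"
proof -
  define c where "c = chart_at A p"
  have c: "c \<in> A" "p \<in> fst c"
    using someI[of "\<lambda>c. c \<in> A \<and> p \<in> fst c"] p by (auto simp: c_def chart_at_def)
  have skew: "\<Pi>\<^sub>P c p j i = - \<Pi>\<^sub>P c p i j" if "i \<in> Basis" "j \<in> Basis" for i j
    using B c that unfolding bivector_field_def by blast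
  let ?s = "\<Sum>i\<in>Basis. \<Sum>j\<in>Basis. \<Pi>\<^sub>P c p i j *\<^sub>R (\<alpha> c p i ** \<beta> c p j)"
  have "(\<Sum>i\<in>Basis. \<Sum>j\<in>Basis. \<Pi>\<^sub>P c p i j *\<^sub>R (\<alpha> c p j ** \<beta> c p i)) =
      (\<Sum>j\<in>Basis. \<Sum>i\<in>Basis. \<Pi>\<^sub>P c p i j *\<^sub>R (\<alpha> c p j ** \<beta> c p i))"
    by (rule sum.swap)
  also have "\<dots> = (\<Sum>j\<in>Basis. \<Sum>i\<in>Basis. - (\<Pi>\<^sub>P c p j i *\<^sub>R (\<alpha> c p j ** \<beta> c p i)))"
  proof (intro sum.cong refl)
    fix i j :: 'e assume "j \<in> Basis" "i \<in> Basis"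
    then have "\<Pi>\<^sub>P c p i j = - \<Pi>\<^sub>P c p j i" by (intro skew)
    then show "\<Pi>\<^sub>P c p i j *\<^sub>R (\<alpha> c p j ** \<beta> c p i) = - (\<Pi>\<^sub>P c p j i *\<^sub>R (\<alpha> c p j ** \<beta> c p i))"
      by (simp only: scaleR_minus_left)
  qed
  also have "\<dots> = - ?s"
    by (simp add: sum_negf)
  finally have "(\<Sum>i\<in>Basis. \<Sum>j\<in>Basis. \<Pi>\<^sub>P c p i j *\<^sub>R wedge \<alpha> \<beta> c p i j) = ?s + ?s"
    by (simp add: wedge_def scaleR_diff_right sum_subtractf)
  then show ?thesis
    by (simp add: contraction_def Let_def c_def[symmetric] scaleR_2[symmetric])
qed


section \<open>Regular eigenvalue functions\<close>

definition null_sp :: "complex^'N^'N \<Rightarrow> (complex^'N) set" where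
  "null_sp K = {v. K *v v = 0}"

definition range_sp :: "complex^'N^'N \<Rightarrow> (complex^'N) set" where
  "range_sp K = range ((*v) K)"

definition complementary :: "(complex^'N) set \<Rightarrow> (complex^'N) set \<Rightarrow> bool" where
  "complementary U V \<longleftrightarrow> U \<inter> V = {0} \<and> (\<forall>w. \<exists>u\<in>U. \<exists>v\<in>V. w = u + v)"

text \<open>When null space and range of \<open>H - \<lambda>I\<close> are complementary, the algebraic multiplicity of \<open>\<lambda>\<close>
  equals the geometric one, which is used here.\<close>

definition regular_eigenvalue_function ::
    "'p topology \<Rightarrow> ('p, 'e::euclidean_space) chart set \<Rightarrow> ('p \<Rightarrow> complex^'N^'N) \<Rightarrow>
     ('p \<Rightarrow> complex) \<Rightarrow> bool" where
  "regular_eigenvalue_function X A H lam \<longleftrightarrow>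
     smooth_map A lam \<and>
     (\<forall>x\<in>topspace X. \<exists>v. v \<noteq> 0 \<and> H x *v v = lam x *s v) \<and>
     (\<exists>m. \<forall>x\<in>topspace X. vec.dim (null_sp (H x - mat (lam x))) = m) \<and>
     (\<forall>x\<in>topspace X.
        complementary (null_sp (H x - mat (lam x))) (range_sp (H x - mat (lam x))))"

definition projection_along :: "(complex^'N) set \<Rightarrow> (complex^'N) set \<Rightarrow> complex^'N^'N" where
  "projection_along U V = (THE M. (\<forall>u\<in>U. M *v u = u) \<and> (\<forall>v\<in>V. M *v v = 0))"

definition eigenprojection ::
    "('p \<Rightarrow> complex^'N^'N) \<Rightarrow> ('p \<Rightarrow> complex) \<Rightarrow> 'p \<Rightarrow> complex^'N^'N" where
  "eigenprojection H lam x =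
     projection_along (null_sp (H x - mat (lam x))) (range_sp (H x - mat (lam x)))"


section \<open>Geometry of the eigenbundle\<close>

text \<open>In this section \<open>\<pi>\<close> is a projection-valued function. The fibres over \<open>p\<close> of the bundles
  \<open>E\<close> and \<open>E\<^sup>\<bottom>\<close> are the image and the null space of \<open>\<pi> p\<close>.\<close>

definition E_sections ::
    "'p topology \<Rightarrow> ('p, 'e::euclidean_space) chart set \<Rightarrow> ('p \<Rightarrow> complex^'N^'N) \<Rightarrow>
     ('p \<Rightarrow> complex^'N) set" where
  "E_sections X A \<pi> = {\<zeta>. smooth_map A \<zeta> \<and> (\<forall>p\<in>topspace X. \<zeta> p \<in> range_sp (\<pi> p))}"

definition Eperp_sections ::
    "'p topology \<Rightarrow> ('p, 'e::euclidean_space) chart set \<Rightarrow> ('p \<Rightarrow> complex^'N^'N) \<Rightarrow>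
     ('p \<Rightarrow> complex^'N) set" where
  "Eperp_sections X A \<pi> = {\<eta>. smooth_map A \<eta> \<and> (\<forall>p\<in>topspace X. \<eta> p \<in> null_sp (\<pi> p))}"

definition proj_connection ::
    "('p \<Rightarrow> complex^'N^'N) \<Rightarrow> ('p \<Rightarrow> complex^'N) \<Rightarrow>
     ('p, 'e::euclidean_space, complex^'N) form1" where
  "proj_connection \<pi> \<zeta> c p h = \<pi> p *v differential \<zeta> c p h"

text \<open>The extension of the connection \<open>D\<close> to \<open>E\<close>-valued 1-forms,
  \<open>(D\<alpha>)(Y, Z) = D\<^sub>Y (\<alpha>(Z)) - D\<^sub>Z (\<alpha>(Y)) - \<alpha>([Y, Z])\<close>, on the (commuting) vector
  fields with constant components \<open>h\<close> and \<open>k\<close> in the chart \<open>c\<close>.\<close>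

definition cov_ext_derivative ::
    "('p \<Rightarrow> complex^'N^'N) \<Rightarrow> ('p, 'e::euclidean_space, complex^'N) form1 \<Rightarrow>
     ('p, 'e, complex^'N) form2" where
  "cov_ext_derivative \<pi> \<alpha> c p h k =
     proj_connection \<pi> (\<lambda>q. \<alpha> c q k) c p h - proj_connection \<pi> (\<lambda>q. \<alpha> c q h) c p k"

text \<open>A homomorphism from the image (null space) of \<open>\<pi> p\<close> to the image or null space of \<open>\<pi> p\<close> is
  represented by the \<open>N \<times> N\<close> matrix that extends it by zero on the null space (image) of \<open>\<pi> p\<close>;
  composition is then matrix multiplication. Each of the following forms takes as value the unique
  homomorphism with the stated action on sections.\<close>

definition curvature ::
    "'p topology \<Rightarrow> ('p, 'e::euclidean_space) chart set \<Rightarrow> ('p \<Rightarrow> complex^'N^'N) \<Rightarrow>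
     ('p, 'e, complex^'N^'N) form2" where
  "curvature X A \<pi> c p h k = (THE M. M = \<pi> p ** M ** \<pi> p \<and>
     (\<forall>\<zeta>\<in>E_sections X A \<pi>.
        cov_ext_derivative \<pi> (proj_connection \<pi> \<zeta>) c p h k = M *v \<zeta> p))"

definition second_fund ::
    "'p topology \<Rightarrow> ('p, 'e::euclidean_space) chart set \<Rightarrow> ('p \<Rightarrow> complex^'N^'N) \<Rightarrow>
     ('p, 'e, complex^'N^'N) form1" where
  "second_fund X A \<pi> c p h = (THE M. M = (mat 1 - \<pi> p) ** M ** \<pi> p \<and>
     (\<forall>\<zeta>\<in>E_sections X A \<pi>. M *v \<zeta> p = (mat 1 - \<pi> p) *v differential \<zeta> c p h))"

definition second_fund_star ::
    "'p topology \<Rightarrow> ('p, 'e::euclidean_space) chart set \<Rightarrow> ('p \<Rightarrow> complex^'N^'N) \<Rightarrow>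
     ('p, 'e, complex^'N^'N) form1" where
  "second_fund_star X A \<pi> c p h = (THE M. M = \<pi> p ** M ** (mat 1 - \<pi> p) \<and>
     (\<forall>\<eta>\<in>Eperp_sections X A \<pi>. M *v \<eta> p = - (\<pi> p *v differential \<eta> c p h)))"

end

theory Submission
  imports Defs
begin

text \<open>Write \<open>K = H\<^sub>0 - \<lambda>I\<close> and \<open>\<pi> = \<pi>\<^sub>0\<close>. Differentiating \<open>\<pi>\<pi> = \<pi>\<close> gives \<open>\<pi> d\<pi> \<pi> = 0\<close>, from which
  \<open>S = d\<pi> \<pi>\<close>, \<open>S\<^sup>* = \<pi> d\<pi>\<close> and \<open>F = S\<^sup>* \<and> S\<close>. Differentiating \<open>K\<pi> = 0\<close> gives \<open>dK \<pi> = - K d\<pi> \<pi>\<close>, so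
  \<open>\<pi>{\<pi>, K}\<pi>\<close> is the contraction of \<open>- S\<^sup>* \<and> K S\<close>; as \<open>K S = (H\<^sub>0 - \<lambda>\<pi>) S - \<lambda> S\<close>, the formula follows.
  The forms \<open>F\<close>, \<open>S\<close>, \<open>S\<^sup>*\<close> are determined by their action on smooth sections. Enough of these exist,
  namely \<open>\<pi> v\<close> and \<open>v - \<pi> v\<close> for constant \<open>v\<close>, because \<open>\<pi>\<close> is smooth.\<close>

section \<open>Calculus of smooth functions\<close>

lemma k_smooth_on_subset: "k_smooth_on k S f \<Longrightarrow> T \<subseteq> S \<Longrightarrow> k_smooth_on k T f"
  by (induction k arbitrary: f) (auto intro: continuous_on_subset)

text \<open>Openness of \<open>S\<close> turns equality on \<open>S\<close> into equality near each
  of its points. The derivatives therefore agree on \<open>S\<close> as well, and induction on the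
  order applies to them.\<close>

lemma k_smooth_on_cong:
  assumes "open S" "k_smooth_on k S f" "\<And>x. x \<in> S \<Longrightarrow> f x = g x"
  shows "k_smooth_on k S g"
  using assms(2,3)
proof (induction k arbitrary: f g)
  case 0
  then show ?case by (simp cong: continuous_on_cong)
next
  case (Suc k)
  have d: "g differentiable (at x)" "frechet_derivative f (at x) = frechet_derivative g (at x)"
    if "x \<in> S" for x
  proof -
    have "f differentiable (at x)" using Suc.prems that by simp
    then obtain f' where f': "(f has_derivative f') (at x)" by (auto simp: differentiable_def)
    have "(g has_derivative f') (at x)"
      using has_derivative_transform_within_open[OF f' \<open>open S\<close> that] Suc.prems by simp
    with f' show "g differentiable (at x)" "frechet_derivative f (at x) = frechet_derivative g (at x)"
      by (auto simp: differentiable_def frechet_derivative_at[symmetric])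
  qed
  have "k_smooth_on k S (\<lambda>x. frechet_derivative g (at x) h)" for h
  proof (rule Suc.IH)
    show "k_smooth_on k S (\<lambda>x. frechet_derivative f (at x) h)" using Suc.prems by simp
  qed (simp add: d)
  then show ?case using d by simp
qed

lemma k_smooth_on_SucD: "k_smooth_on (Suc k) S f \<Longrightarrow> k_smooth_on k S f"
proof (induction k arbitrary: f)
  case 0
  then have "continuous (at x) f" if "x \<in> S" for x
    using that differentiable_imp_continuous_within[of f x UNIV] by simp
  then show ?case by (simp add: continuous_at_imp_continuous_on)
next
  case (Suc k)
  \<comment> \<open>Only the outer successor of \<open>Suc (Suc k)\<close> is unfolded, so that the
    directional derivatives keep the form \<open>k_smooth_on (Suc k)\<close> to which the induction
    hypothesis applies.\<close>
  then have "\<forall>x\<in>S. f differentiable (at x)" by (simp del: k_smooth_on.simps add: k_smooth_on.simps(2)[of "Suc k"])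
  moreover have "k_smooth_on k S (\<lambda>x. frechet_derivative f (at x) h)" for h
    using Suc.prems by (intro Suc.IH) (simp del: k_smooth_on.simps add: k_smooth_on.simps(2)[of "Suc k"])
  ultimately show ?case by simp
qed

lemma k_smooth_on_imp_continuous_on: "k_smooth_on k S f \<Longrightarrow> continuous_on S f"
proof (induction k)
  case (Suc k)
  then show ?case by (blast dest: k_smooth_on_SucD)
qed simp

text \<open>Together with \<open>k_smooth_on_SucE\<close> this trades
  \<open>frechet_derivative\<close> for an explicit derivative \<open>f'\<close>, by uniqueness of
  derivatives. The closure proofs then reduce to the usual differentiation rules.\<close>

lemma k_smooth_on_SucI:
  assumes "open S" and f': "\<And>x. x \<in> S \<Longrightarrow> (f has_derivative f' x) (at x)"
    and "\<And>h. k_smooth_on k S (\<lambda>x. f' x h)"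
  shows "k_smooth_on (Suc k) S f"
proof -
  have "k_smooth_on k S (\<lambda>x. frechet_derivative f (at x) h)" for h
    using frechet_derivative_at[OF f'] by (intro k_smooth_on_cong[OF assms(1) assms(3)[of h]]) metis
  then show ?thesis using f' by (auto simp: differentiable_def)
qed

text \<open>The third conclusion serves the product and reciprocal rules, whose derivatives contain
  undifferentiated factors.\<close>

lemma k_smooth_on_SucE:
  assumes "k_smooth_on (Suc k) S f"
  obtains f' where "\<And>x. x \<in> S \<Longrightarrow> (f has_derivative f' x) (at x)"
    "\<And>h. k_smooth_on k S (\<lambda>x. f' x h)" "k_smooth_on k S f"
proof
  show "(f has_derivative frechet_derivative f (at x)) (at x)" if "x \<in> S" for x
    using assms that by (simp add: frechet_derivative_works)
  show "k_smooth_on k S (\<lambda>x. frechet_derivative f (at x) h)" for h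
    using assms by simp
  show "k_smooth_on k S f" using assms by (rule k_smooth_on_SucD)
qed

text \<open>Differentiability and continuity are tested point by point. This lets a function that
  has an explicit formula only near each point, such as the null projection, be smooth on its whole
  domain.\<close>

lemma k_smooth_on_local:
  assumes "\<And>x. x \<in> S \<Longrightarrow> \<exists>U. open U \<and> x \<in> U \<and> k_smooth_on k U f"
  shows "k_smooth_on k S f"
  using assms
proof (induction k arbitrary: f)
  case 0
  have "continuous (at x) f" if "x \<in> S" for x
    using 0[OF that] by (auto simp: continuous_on_eq_continuous_at)
  then show ?case by (simp add: continuous_at_imp_continuous_on)
next
  case (Suc k)
  have "\<forall>x\<in>S. f differentiable (at x)" using Suc.prems by fastforce
  moreover have "k_smooth_on k S (\<lambda>x. frechet_derivative f (at x) h)" for h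
    using Suc.prems by (intro Suc.IH) fastforce
  ultimately show ?case by simp
qed

section \<open>Closure of smoothness under algebraic operations\<close>

lemma k_smooth_on_const: "open S \<Longrightarrow> k_smooth_on k S (\<lambda>x. c)"
proof (induction k arbitrary: c)
  case (Suc k)
  then show ?case by (intro k_smooth_on_SucI[where f'="\<lambda>x h. 0"]) auto
qed simp

lemma k_smooth_on_bounded_linear:
  assumes "open S" and L: "bounded_linear L" and "k_smooth_on k S f"
  shows "k_smooth_on k S (\<lambda>x. L (f x))"
  using assms(3)
proof (induction k arbitrary: f)
  case 0
  then show ?case by (simp add: bounded_linear.continuous_on[OF L])
next
  case (Suc k)
  from Suc.prems obtain f' where "\<And>x. x \<in> S \<Longrightarrow> (f has_derivative f' x) (at x)"
    "\<And>h. k_smooth_on k S (\<lambda>x. f' x h)" by (rule k_smooth_on_SucE) blast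
  then show ?case
    by (intro k_smooth_on_SucI[where f'="\<lambda>x h. L (f' x h)"] \<open>open S\<close> Suc.IH)
      (auto intro: bounded_linear.has_derivative[OF L])
qed

lemma k_smooth_on_add:
  assumes "open S" and "k_smooth_on k S f" "k_smooth_on k S g"
  shows "k_smooth_on k S (\<lambda>x. f x + g x)"
  using assms(2,3)
proof (induction k arbitrary: f g)
  case 0
  then show ?case by (simp add: continuous_on_add)
next
  case (Suc k)
  from Suc.prems(1) obtain f' where f': "\<And>x. x \<in> S \<Longrightarrow> (f has_derivative f' x) (at x)"
    "\<And>h. k_smooth_on k S (\<lambda>x. f' x h)" by (rule k_smooth_on_SucE) blast
  from Suc.prems(2) obtain g' where g': "\<And>x. x \<in> S \<Longrightarrow> (g has_derivative g' x) (at x)"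
    "\<And>h. k_smooth_on k S (\<lambda>x. g' x h)" by (rule k_smooth_on_SucE) blast
  show ?case
    by (intro k_smooth_on_SucI[where f'="\<lambda>x h. f' x h + g' x h"] \<open>open S\<close> Suc.IH)
      (auto intro: has_derivative_add f' g')
qed

lemma k_smooth_on_minus:
  "open S \<Longrightarrow> k_smooth_on k S f \<Longrightarrow> k_smooth_on k S (\<lambda>x. - f x)"
  by (rule k_smooth_on_bounded_linear) (auto intro: bounded_linear_minus bounded_linear_ident)

lemma k_smooth_on_diff:
  assumes "open S" "k_smooth_on k S f" "k_smooth_on k S g"
  shows "k_smooth_on k S (\<lambda>x. f x - g x)"
  using k_smooth_on_add[OF assms(1,2) k_smooth_on_minus[OF assms(1,3)]] by simp

lemma k_smooth_on_sum:
  assumes "open S" "\<And>i. i \<in> I \<Longrightarrow> k_smooth_on k S (f i)"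
  shows "k_smooth_on k S (\<lambda>x. \<Sum>i\<in>I. f i x)"
  using assms(2)
  by (induction I rule: infinite_finite_induct)
    (auto intro: k_smooth_on_add k_smooth_on_const \<open>open S\<close>)

text \<open>The Leibniz rule gives two values of \<open>B\<close> with one argument differentiated
  in each, so the induction runs over all pairs \<open>f\<close>, \<open>g\<close>. Scalar, matrix
  and matrix-vector products are all instances.\<close>

lemma k_smooth_on_bilinear:
  assumes "open S" and B: "bounded_bilinear B" and "k_smooth_on k S f" "k_smooth_on k S g"
  shows "k_smooth_on k S (\<lambda>x. B (f x) (g x))"
  using assms(3,4)
proof (induction k arbitrary: f g)
  case 0
  then show ?case by (simp add: bounded_bilinear.continuous_on[OF B])
next
  case (Suc k)
  from Suc.prems(1) obtain f' where f': "\<And>x. x \<in> S \<Longrightarrow> (f has_derivative f' x) (at x)"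
    "\<And>h. k_smooth_on k S (\<lambda>x. f' x h)" "k_smooth_on k S f" by (rule k_smooth_on_SucE) blast
  from Suc.prems(2) obtain g' where g': "\<And>x. x \<in> S \<Longrightarrow> (g has_derivative g' x) (at x)"
    "\<And>h. k_smooth_on k S (\<lambda>x. g' x h)" "k_smooth_on k S g" by (rule k_smooth_on_SucE) blast
  show ?case
    by (intro k_smooth_on_SucI[where f'="\<lambda>x h. B (f x) (g' x h) + B (f' x h) (g x)"] \<open>open S\<close>
          k_smooth_on_add Suc.IH)
      (auto intro: bounded_bilinear.FDERIV[OF B] f' g')
qed

lemma k_smooth_on_prod:
  fixes f :: "'i \<Rightarrow> 'e::euclidean_space \<Rightarrow> 'a::real_normed_field"
  assumes "open S" "\<And>i. i \<in> I \<Longrightarrow> k_smooth_on k S (f i)"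
  shows "k_smooth_on k S (\<lambda>x. \<Prod>i\<in>I. f i x)"
  using assms(2)
  by (induction I rule: infinite_finite_induct)
    (auto intro: k_smooth_on_bilinear k_smooth_on_const bounded_bilinear_mult \<open>open S\<close>)

text \<open>The derivative of the reciprocal is a product of \<open>f'\<close> with two copies of
  the reciprocal, so smoothness of order \<open>k\<close> of the reciprocal lifts itself to order
  \<open>k + 1\<close>.\<close>

lemma k_smooth_on_inverse:
  fixes f :: "'e::euclidean_space \<Rightarrow> 'a::real_normed_field"
  assumes "open S" "\<And>x. x \<in> S \<Longrightarrow> f x \<noteq> 0" "k_smooth_on k S f"
  shows "k_smooth_on k S (\<lambda>x. inverse (f x))"
  using assms(3)
proof (induction k)
  case 0
  then show ?case using assms(2) by (auto intro!: continuous_intros)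
next
  case (Suc k)
  from Suc.prems obtain f' where f': "\<And>x. x \<in> S \<Longrightarrow> (f has_derivative f' x) (at x)"
    "\<And>h. k_smooth_on k S (\<lambda>x. f' x h)" "k_smooth_on k S f" by (rule k_smooth_on_SucE) blast
  show ?case
    by (intro k_smooth_on_SucI[where f'="\<lambda>x h. - (inverse (f x) * f' x h * inverse (f x))"]
          k_smooth_on_minus k_smooth_on_bilinear[OF _ bounded_bilinear_mult] Suc.IH f'(2,3) \<open>open S\<close>)
      (rule Deriv.has_derivative_inverse[OF assms(2) f'(1)]; assumption)
qed

lemma k_smooth_on_vec_nth:
  "open S \<Longrightarrow> k_smooth_on k S f \<Longrightarrow> k_smooth_on k S (\<lambda>x. f x $ i)"
  by (rule k_smooth_on_bounded_linear[OF _ bounded_linear_vec_nth])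

lemma bounded_linear_axis: "bounded_linear (axis i :: 'a::euclidean_space \<Rightarrow> 'a^'n)"
proof (rule linear_conv_bounded_linear[THEN iffD1], rule linearI)
qed (auto simp: axis_def vec_eq_iff)

lemma k_smooth_on_vec_lambda:
  fixes f :: "'n::finite \<Rightarrow> 'e::euclidean_space \<Rightarrow> 'a::euclidean_space"
  assumes "open S" "\<And>i. k_smooth_on k S (f i)"
  shows "k_smooth_on k S (\<lambda>x. \<chi> i. f i x)"
proof -
  have "k_smooth_on k S (\<lambda>x. \<Sum>i\<in>UNIV. axis i (f i x))"
    by (intro k_smooth_on_sum k_smooth_on_bounded_linear[OF _ bounded_linear_axis] assms)
  moreover have "(\<lambda>x. \<Sum>i\<in>UNIV. axis i (f i x)) = (\<lambda>x. \<chi> i. f i x)"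
    by (simp add: fun_eq_iff vec_eq_iff axis_def if_distrib cong: if_cong)
  ultimately show ?thesis by simp
qed

section \<open>Determinants and matrix inverses\<close>

lemma k_smooth_on_det:
  fixes M :: "'e::euclidean_space \<Rightarrow> complex^'N^'N"
  assumes "open S" "\<And>i j. k_smooth_on k S (\<lambda>x. M x $ i $ j)"
  shows "k_smooth_on k S (\<lambda>x. det (M x))"
  unfolding det_def
  by (intro k_smooth_on_sum k_smooth_on_prod k_smooth_on_const assms
      k_smooth_on_bilinear[OF _ bounded_bilinear_mult])

text \<open>Cramer's rule writes each entry of the inverse as a quotient of determinants in the
  entries of \<open>M\<close>. Hence an \<open>N\<close> chosen pointwise is automatically
  smooth.\<close>

lemma k_smooth_on_matrix_inverse:
  fixes M :: "'e::euclidean_space \<Rightarrow> complex^'N^'N"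
  assumes "open S" and M: "k_smooth_on k S M" and N: "\<And>x. x \<in> S \<Longrightarrow> M x ** N x = mat 1"
  shows "k_smooth_on k S N"
proof -
  \<comment> \<open>\<open>C x a b\<close> is \<open>M x\<close> with column \<open>a\<close>
    replaced by the unit vector with index \<open>b\<close>; its determinant is the Cramer numerator
    for the entry of \<open>N x\<close> in row \<open>a\<close> and column \<open>b\<close>.\<close>
  define C :: "'e \<Rightarrow> 'N \<Rightarrow> 'N \<Rightarrow> complex^'N^'N" where
    "C x a b = (\<chi> i j. if j = a then column b (mat 1) $ i else M x $ i $ j)" for x a b
  have det: "det (M x) \<noteq> 0" if "x \<in> S" for x
    using N[OF that] by (metis invertible_det_nz invertible_def matrix_left_right_inverse)
  have eq: "(\<chi> a b. det (C x a b) * inverse (det (M x))) = N x" if "x \<in> S" for x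
  proof -
    have "M x *v column b (N x) = column b (mat 1)" for b
      using N[OF that] by (simp add: vec_eq_iff column_def matrix_vector_mult_def matrix_matrix_mult_def)
    then have "N x $ a $ b = det (C x a b) / det (M x)" for a b
      using cramer[OF det[OF that], of "column b (N x)" "column b (mat 1)"]
      by (simp add: vec_eq_iff C_def) (simp add: column_def)
    then show ?thesis by (simp add: vec_eq_iff divide_inverse)
  qed
  have "k_smooth_on k S (\<lambda>x. C x a b $ i $ j)" for a b i j
    by (cases "j = a") (simp_all add: C_def k_smooth_on_const k_smooth_on_vec_nth M \<open>open S\<close>)
  then have "k_smooth_on k S (\<lambda>x. det (C x a b))" for a b
    by (intro k_smooth_on_det \<open>open S\<close>)
  moreover have "k_smooth_on k S (\<lambda>x. det (M x))"
    by (intro k_smooth_on_det k_smooth_on_vec_nth M \<open>open S\<close>)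
  ultimately have "k_smooth_on k S (\<lambda>x. \<chi> a b. det (C x a b) * inverse (det (M x)))"
    by (intro k_smooth_on_vec_lambda k_smooth_on_bilinear[OF _ bounded_bilinear_mult]
        k_smooth_on_inverse det \<open>open S\<close>)
  then show ?thesis
    using eq by (rule k_smooth_on_cong[OF \<open>open S\<close>])
qed

section \<open>Matrix operations as bounded (bi)linear maps\<close>

lemma bounded_bilinear_matrix_mult:
  "bounded_bilinear ((**) :: complex^'n^'m \<Rightarrow> complex^'k^'n \<Rightarrow> complex^'k^'m)"
  unfolding bilinear_conv_bounded_bilinear[symmetric] bilinear_def
  by (intro conjI allI linearI)
    (simp_all add: vec_eq_iff matrix_matrix_mult_def scaleR_sum_right sum.distrib ring_distribs)

lemma bounded_bilinear_matrix_vector_mult: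
  "bounded_bilinear ((*v) :: complex^'n^'m \<Rightarrow> complex^'n \<Rightarrow> complex^'m)"
  unfolding bilinear_conv_bounded_bilinear[symmetric] bilinear_def
  by (intro conjI allI linearI)
    (simp_all add: vec_eq_iff matrix_vector_mult_def scaleR_sum_right sum.distrib ring_distribs)

lemma bounded_linear_mat: "bounded_linear (mat :: complex \<Rightarrow> complex^'N^'N)"
  by (intro linear_conv_bounded_linear[THEN iffD1] linearI) (simp_all add: mat_def vec_eq_iff)

section \<open>Symmetry of second derivatives\<close>

lemma has_real_derivative_along_line:
  fixes f :: "'e::real_normed_vector \<Rightarrow> real"
  assumes "(f has_derivative D) (at (x + t *\<^sub>R k))"
  shows "((\<lambda>t. f (x + t *\<^sub>R k)) has_real_derivative D k) (at t)"
proof -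
  have "((\<lambda>t. x + t *\<^sub>R k) has_derivative (\<lambda>s. s *\<^sub>R k)) (at t)"
    by (auto intro!: derivative_eq_intros)
  from has_derivative_compose[OF this assms]
  have "((\<lambda>t. f (x + t *\<^sub>R k)) has_derivative (\<lambda>s. D (s *\<^sub>R k))) (at t)" .
  moreover have "(\<lambda>s. D (s *\<^sub>R k)) = (*) (D k)"
    using linear_scale[OF has_derivative_linear[OF assms]] by (simp add: fun_eq_iff mult.commute)
  ultimately show ?thesis by (simp add: has_field_derivative_def)
qed

text \<open>The mean value theorem is applied twice: in direction \<open>h\<close> to the difference
  of \<open>f\<close> on two lines that are translates by \<open>s *\<^sub>R k\<close>, then in
  direction \<open>k\<close> to the first derivative obtained.\<close>

lemma second_difference_mean_value:
  fixes f :: "'e::real_normed_vector \<Rightarrow> real"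
  assumes f': "\<And>z. z \<in> S \<Longrightarrow> (f has_derivative f' z) (at z)"
    and f'': "\<And>z. z \<in> S \<Longrightarrow> ((\<lambda>z. f' z h) has_derivative f'' z) (at z)"
    and "s > 0"
    and S: "\<And>a b. 0 \<le> a \<Longrightarrow> a \<le> s \<Longrightarrow> 0 \<le> b \<Longrightarrow> b \<le> s \<Longrightarrow> x + a *\<^sub>R h + b *\<^sub>R k \<in> S"
  obtains a b where "0 \<le> a" "a \<le> s" "0 \<le> b" "b \<le> s"
    "f (x + s *\<^sub>R h + s *\<^sub>R k) - f (x + s *\<^sub>R h) - f (x + s *\<^sub>R k) + f x =
      s * s * f'' (x + a *\<^sub>R h + b *\<^sub>R k) k"
proof -
  let ?u = "\<lambda>t. f (x + s *\<^sub>R k + t *\<^sub>R h) - f (x + t *\<^sub>R h)"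
  have u: "(?u has_real_derivative f' (x + s *\<^sub>R k + t *\<^sub>R h) h - f' (x + t *\<^sub>R h) h) (at t)"
    if "0 \<le> t" "t \<le> s" for t
    using S[OF that, of s] S[OF that, of 0] \<open>s > 0\<close>
    by (intro DERIV_diff has_real_derivative_along_line f') (simp_all add: algebra_simps)
  obtain a where a: "0 < a" "a < s"
    "?u s - ?u 0 = (s - 0) * (f' (x + s *\<^sub>R k + a *\<^sub>R h) h - f' (x + a *\<^sub>R h) h)"
    using MVT2[OF \<open>s > 0\<close>, of ?u, OF u] by blast
  let ?v = "\<lambda>t. f' (x + a *\<^sub>R h + t *\<^sub>R k) h"
  have v: "(?v has_real_derivative f'' (x + a *\<^sub>R h + t *\<^sub>R k) k) (at t)" if "0 \<le> t" "t \<le> s" for t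
    using S[OF _ _ that, of a] a by (intro has_real_derivative_along_line[where f="\<lambda>z. f' z h"] f'') simp
  obtain b where b: "0 < b" "b < s"
    "?v s - ?v 0 = (s - 0) * f'' (x + a *\<^sub>R h + b *\<^sub>R k) k"
    using MVT2[OF \<open>s > 0\<close>, of ?v, OF v] by blast
  have "f (x + s *\<^sub>R h + s *\<^sub>R k) - f (x + s *\<^sub>R h) - f (x + s *\<^sub>R k) + f x =
      s * s * f'' (x + a *\<^sub>R h + b *\<^sub>R k) k"
    using a(3) b(3) by (simp add: algebra_simps)
  with a b show ?thesis by (intro that[of a b]) auto
qed

text \<open>Schwarz's theorem. The second difference over a small parallelogram is symmetric in
  \<open>h\<close> and \<open>k\<close>, so its two mean value expressions agree; continuity carries
  this over to the point \<open>x\<close>.\<close>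

lemma mixed_derivatives_commute_real:
  fixes f :: "'e::real_normed_vector \<Rightarrow> real"
  assumes "open S" "x \<in> S"
    and f': "\<And>z. z \<in> S \<Longrightarrow> (f has_derivative f' z) (at z)"
    and fh: "\<And>z. z \<in> S \<Longrightarrow> ((\<lambda>z. f' z h) has_derivative fh z) (at z)"
    and fk: "\<And>z. z \<in> S \<Longrightarrow> ((\<lambda>z. f' z k) has_derivative fk z) (at z)"
    and cont: "continuous_on S (\<lambda>z. fh z k)" "continuous_on S (\<lambda>z. fk z h)"
  shows "fh x k = fk x h"
proof (rule ccontr)
  assume "fh x k \<noteq> fk x h"
  \<comment> \<open>With half the gap as tolerance, a single number within \<open>e\<close> of both
    mixed derivatives at \<open>x\<close> is contradictory.\<close>
  define e where "e = \<bar>fh x k - fk x h\<bar> / 2"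
  have "e > 0" using \<open>fh x k \<noteq> fk x h\<close> by (simp add: e_def)
  have "isCont (\<lambda>z. fh z k) x" "isCont (\<lambda>z. fk z h) x"
    using cont assms(1,2) by (simp_all add: continuous_on_eq_continuous_at)
  then have "\<exists>d>0. \<forall>z. dist z x < d \<longrightarrow> dist (fh z k) (fh x k) < e"
    "\<exists>d>0. \<forall>z. dist z x < d \<longrightarrow> dist (fk z h) (fk x h) < e"
    using \<open>e > 0\<close> by (simp_all add: continuous_at_eps_delta)
  then obtain d1 d2 where d: "d1 > 0" "d2 > 0"
    "\<And>z. dist z x < d1 \<Longrightarrow> dist (fh z k) (fh x k) < e"
    "\<And>z. dist z x < d2 \<Longrightarrow> dist (fk z h) (fk x h) < e"
    by auto
  obtain d3 where d3: "d3 > 0" "\<And>z. dist z x < d3 \<Longrightarrow> z \<in> S"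
    using assms(1,2) unfolding open_dist by blast
  define d where "d = min d1 (min d2 d3)"
  \<comment> \<open>The summand 1 keeps \<open>q\<close> positive even if \<open>h\<close> and
    \<open>k\<close> vanish; the factor 2 in \<open>s\<close> then places the parallelogram strictly
    inside the ball of radius \<open>d\<close>.\<close>
  define q where "q = norm h + norm k + 1"
  define s where "s = d / (2 * q)"
  have "d > 0" using d d3 by (simp add: d_def)
  have "q > 0" unfolding q_def by (smt (verit) norm_ge_zero)
  then have "s > 0" using \<open>d > 0\<close> by (simp add: s_def)
  have near: "dist (x + a *\<^sub>R h + b *\<^sub>R k) x < d" if "0 \<le> a" "a \<le> s" "0 \<le> b" "b \<le> s" for a b
  proof -
    have "dist (x + a *\<^sub>R h + b *\<^sub>R k) x \<le> a * norm h + b * norm k"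
      using that norm_triangle_ineq[of "a *\<^sub>R h" "b *\<^sub>R k"] by (simp add: dist_norm add.assoc)
    also have "\<dots> \<le> s * norm h + s * norm k"
      using that by (intro add_mono mult_right_mono) auto
    also have "\<dots> \<le> s * q"
      using \<open>s > 0\<close> by (simp add: algebra_simps q_def)
    also have "\<dots> = d / 2" using \<open>q > 0\<close> by (simp add: s_def)
    finally show ?thesis using \<open>d > 0\<close> by simp
  qed
  then have S: "x + a *\<^sub>R h + b *\<^sub>R k \<in> S" "x + b *\<^sub>R k + a *\<^sub>R h \<in> S"
    if "0 \<le> a" "a \<le> s" "0 \<le> b" "b \<le> s" for a b
    using d3(2) that by (auto simp: d_def ac_simps)
  obtain a b where ab: "0 \<le> a" "a \<le> s" "0 \<le> b" "b \<le> s"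
    "f (x + s *\<^sub>R h + s *\<^sub>R k) - f (x + s *\<^sub>R h) - f (x + s *\<^sub>R k) + f x =
      s * s * fh (x + a *\<^sub>R h + b *\<^sub>R k) k"
    using second_difference_mean_value[OF f' fh \<open>s > 0\<close> S(1)] by blast
  \<comment> \<open>The roles of \<open>h\<close> and \<open>k\<close> are exchanged:
    \<open>a'\<close> is a coefficient of \<open>k\<close>, which is why the bounds enter
    \<open>near\<close> in swapped order below.\<close>
  obtain a' b' where ab': "0 \<le> a'" "a' \<le> s" "0 \<le> b'" "b' \<le> s"
    "f (x + s *\<^sub>R k + s *\<^sub>R h) - f (x + s *\<^sub>R k) - f (x + s *\<^sub>R h) + f x =
      s * s * fk (x + a' *\<^sub>R k + b' *\<^sub>R h) h"
    using second_difference_mean_value[OF f' fk \<open>s > 0\<close> S(2)] by blast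
  have "fh (x + a *\<^sub>R h + b *\<^sub>R k) k = fk (x + a' *\<^sub>R k + b' *\<^sub>R h) h"
    using ab(5) ab'(5) \<open>s > 0\<close> by (simp add: algebra_simps)
  moreover have "dist (fh (x + a *\<^sub>R h + b *\<^sub>R k) k) (fh x k) < e"
    using near[OF ab(1-4)] by (intro d) (simp add: d_def)
  moreover have "dist (fk (x + a' *\<^sub>R k + b' *\<^sub>R h) h) (fk x h) < e"
    using near[OF ab'(3,4,1,2)] by (intro d) (simp add: d_def ac_simps)
  ultimately show False
    unfolding e_def dist_real_def by (smt (verit) field_sum_of_halves)
qed

text \<open>Pairing with each basis vector \<open>b\<close> of the target reduces this to the
  real-valued case.\<close>

lemma mixed_derivatives_commute:
  fixes f :: "'e::euclidean_space \<Rightarrow> 'v::euclidean_space"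
  assumes "open S" "x \<in> S" and f: "k_smooth_on (Suc (Suc 0)) S f"
  shows "frechet_derivative (\<lambda>y. frechet_derivative f (at y) h) (at x) k =
    frechet_derivative (\<lambda>y. frechet_derivative f (at y) k) (at x) h"
proof (rule euclidean_eqI)
  fix b :: 'v
  let ?D = "\<lambda>z. frechet_derivative f (at z)"
  have 1: "(f has_derivative ?D z) (at z)" if "z \<in> S" for z
    using f that by (simp add: frechet_derivative_works)
  have 2: "((\<lambda>z. ?D z h) has_derivative frechet_derivative (\<lambda>z. ?D z h) (at z)) (at z)"
    if "z \<in> S" for z h
    using f that by (simp add: frechet_derivative_works)
  have 3: "continuous_on S (\<lambda>z. frechet_derivative (\<lambda>z. ?D z h) (at z) k \<bullet> b)" for h k
    using f by (intro continuous_on_inner continuous_on_const) simp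
  show "frechet_derivative (\<lambda>z. ?D z h) (at x) k \<bullet> b = frechet_derivative (\<lambda>z. ?D z k) (at x) h \<bullet> b"
  proof (rule mixed_derivatives_commute_real[OF assms(1,2), where f="\<lambda>z. f z \<bullet> b"
        and f'="\<lambda>z h. ?D z h \<bullet> b"
        and fh="\<lambda>z k. frechet_derivative (\<lambda>z. ?D z h) (at z) k \<bullet> b"
        and fk="\<lambda>z h. frechet_derivative (\<lambda>z. ?D z k) (at z) h \<bullet> b"])
    show "((\<lambda>z. f z \<bullet> b) has_derivative (\<lambda>h. ?D z h \<bullet> b)) (at z)" if "z \<in> S" for z
      by (rule has_derivative_inner_left[OF 1[OF that]])
    show "((\<lambda>z. ?D z h \<bullet> b) has_derivative
        (\<lambda>k. frechet_derivative (\<lambda>z. ?D z h) (at z) k \<bullet> b)) (at z)" if "z \<in> S" for z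
      by (rule has_derivative_inner_left[OF 2[OF that]])
    show "((\<lambda>z. ?D z k \<bullet> b) has_derivative
        (\<lambda>h. frechet_derivative (\<lambda>z. ?D z k) (at z) h \<bullet> b)) (at z)" if "z \<in> S" for z
      by (rule has_derivative_inner_left[OF 2[OF that]])
  qed (rule 3)+
qed

section \<open>Smoothness of the eigenprojection\<close>

interpretation matrix_mult: bounded_bilinear
  "(**) :: complex^'n^'m \<Rightarrow> complex^'k^'n \<Rightarrow> complex^'k^'m"
  by (rule bounded_bilinear_matrix_mult)

interpretation matrix_vector_mult: bounded_bilinear
  "(*v) :: complex^'n^'m \<Rightarrow> complex^'n \<Rightarrow> complex^'m"
  by (rule bounded_bilinear_matrix_vector_mult)

lemma mat_mult_commute: "mat z ** (M :: complex^'N^'N) = M ** mat z"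
  by (simp add: vec_eq_iff matrix_matrix_mult_def mat_def if_distrib if_distribR mult.commute cong: if_cong)

section \<open>Projections along complementary subspaces\<close>

lemma subspace_null_sp: "vec.subspace (null_sp K)"
  by (auto simp: vec.subspace_def null_sp_def vec.add vec.scale)

lemma subspace_range_sp: "vec.subspace (range_sp K)"
  unfolding range_sp_def by (rule vec.subspace_image) simp

text \<open>Uniqueness of the decomposition makes the \<open>U\<close>-component linear, hence a
  matrix. Any matrix with the two defining properties agrees with it on every
  \<open>f w + g w\<close>, so the definite description is justified.\<close>

lemma projection_along:
  fixes U V :: "(complex^'N) set"
  assumes U: "vec.subspace U" and V: "vec.subspace V" and c: "complementary U V"
  shows "u \<in> U \<Longrightarrow> projection_along U V *v u = u"
    and "v \<in> V \<Longrightarrow> projection_along U V *v v = 0"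
    and "projection_along U V *v w \<in> U"
    and "w - projection_along U V *v w \<in> V"
proof -
  have un: "u = u'" if "u + v = u' + v'" "u \<in> U" "v \<in> V" "u' \<in> U" "v' \<in> V" for u v u' v'
  proof -
    have "u - u' = v' - v" using that(1) by (simp add: algebra_simps)
    then have "u - u' \<in> U \<inter> V"
      using vec.subspace_diff[OF U that(2,4)] vec.subspace_diff[OF V that(5,3)] by simp
    then have "u - u' = 0" using c unfolding complementary_def by blast
    then show ?thesis by simp
  qed
  obtain f g where fg: "\<And>w. f w \<in> U" "\<And>w. g w \<in> V" "\<And>w. w = f w + g w"
    using c unfolding complementary_def by metis
  have f: "f w = u" if "w = u + v" "u \<in> U" "v \<in> V" for w u v
    using un[of "f w" "g w" u v] fg that by metis
  have lin: "Vector_Spaces.linear (*s) (*s) f"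
  proof (rule Vector_Spaces.linear_iff[THEN iffD2], safe)
    show "f (x + y) = f x + f y" for x y
    proof (rule f)
      show "x + y = (f x + f y) + (g x + g y)" using fg(3)[of x] fg(3)[of y] by (simp add: algebra_simps)
    qed (auto intro: vec.subspace_add U V fg)
    show "f (r *s x) = r *s f x" for r x
    proof (rule f)
      show "r *s x = r *s f x + r *s g x" using fg(3)[of x] by (metis vec.scale_right_distrib)
    qed (auto intro: vec.subspace_scale U V fg)
  qed (auto intro: vec.vector_space_axioms)
  let ?M = "matrix f"
  have M: "?M *v w = f w" for w by (rule matrix_works[OF lin])
  have MU: "?M *v u = u" if "u \<in> U" for u
    unfolding M using that vec.subspace_0[OF V] by (intro f) auto
  have MV: "?M *v v = 0" if "v \<in> V" for v
    unfolding M using that vec.subspace_0[OF U] by (intro f) auto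
  have eq: "projection_along U V = ?M"
    unfolding projection_along_def
  proof (rule the_equality)
    show "(\<forall>u\<in>U. ?M *v u = u) \<and> (\<forall>v\<in>V. ?M *v v = 0)"
      using MU MV by auto
    fix M' assume "(\<forall>u\<in>U. M' *v u = u) \<and> (\<forall>v\<in>V. M' *v v = 0)"
    then have "M' *v (f w + g w) = f w" for w
      using fg(1,2) by (simp add: vec.add)
    then show "M' = ?M"
      using fg(3) M by (metis matrix_eq)
  qed
  show "u \<in> U \<Longrightarrow> projection_along U V *v u = u"
    and "v \<in> V \<Longrightarrow> projection_along U V *v v = 0"
    and "projection_along U V *v w \<in> U"
    using MU MV M fg by (auto simp: eq)
  have "w - f w = g w" using fg(3)[of w] by (metis add_diff_cancel_left')
  then show "w - projection_along U V *v w \<in> V"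
    using M fg by (simp add: eq)
qed

text \<open>Isolates the dependence of the eigenprojection on the single matrix
  \<open>H x - mat (lam x)\<close>, so that its smoothness becomes a question about
  matrices.\<close>

definition null_projection :: "complex^'N^'N \<Rightarrow> complex^'N^'N" where
  "null_projection K = projection_along (null_sp K) (range_sp K)"

text \<open>Matrix forms of the geometric description. In the fourth, \<open>Z'\<close> kills the
  range of \<open>K\<close>, which contains the difference of any vector and its projection.\<close>

lemma null_projection:
  assumes "complementary (null_sp K) (range_sp K)"
  shows "K ** null_projection K = 0"
    and "null_projection K ** K = 0"
    and "K ** Z = 0 \<Longrightarrow> null_projection K ** Z = Z"
    and "Z' ** K = 0 \<Longrightarrow> Z' ** null_projection K = Z'"
    and "null_projection K ** null_projection K = null_projection K"
proof -
  note * = projection_along[OF subspace_null_sp subspace_range_sp assms, folded null_projection_def]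
  show a: "K ** null_projection K = 0"
    using *(3) by (simp add: matrix_eq null_sp_def flip: matrix_vector_mul_assoc)
  show "null_projection K ** K = 0"
    using *(2) by (simp add: matrix_eq range_sp_def flip: matrix_vector_mul_assoc)
  show b: "null_projection K ** Z = Z" if "K ** Z = 0" for Z
    using *(1) that by (simp add: matrix_eq null_sp_def flip: matrix_vector_mul_assoc)
  show "null_projection K ** null_projection K = null_projection K"
    by (rule b[OF a])
  show "Z' ** null_projection K = Z'" if "Z' ** K = 0"
  proof (subst matrix_eq, rule allI)
    fix w
    obtain z where z: "w - null_projection K *v w = K *v z"
      using *(4)[of w] by (auto simp: range_sp_def)
    have "Z' *v (w - null_projection K *v w) = (Z' ** K) *v z"
      unfolding z by (simp add: matrix_vector_mul_assoc)
    then show "(Z' ** null_projection K) *v w = Z' *v w"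
      by (simp add: that vec.diff flip: matrix_vector_mul_assoc)
  qed
qed

text \<open>Because the two null spaces have the same dimension, \<open>K + P\<close> maps \<open>null_sp K\<close> onto
  \<open>null_sp K\<^sub>0\<close>, so its inverse \<open>N\<close> satisfies \<open>K N P = 0\<close>. This turns \<open>null_projection K\<close> into a
  rational expression in the entries of \<open>K\<close>.\<close>

lemma null_projection_perturbation:
  fixes K :: "complex^'N^'N"
  assumes c: "complementary (null_sp K) (range_sp K)"
    and c0: "complementary (null_sp K\<^sub>0) (range_sp K\<^sub>0)"
    and dim: "vec.dim (null_sp K) = vec.dim (null_sp K\<^sub>0)"
    and P: "P = null_projection K\<^sub>0"
    and MN: "(K + P) ** N = mat 1"
  defines "G \<equiv> P ** N ** N ** P + (mat 1 - P)"
  obtains G' where "G ** G' = mat 1" "null_projection K = N ** P ** G' ** P ** N"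
proof -
  let ?\<pi> = "null_projection K"
  have NM: "N ** (K + P) = mat 1" using MN by (simp add: matrix_left_right_inverse)
  note p0 = projection_along[OF subspace_null_sp subspace_range_sp c0, folded null_projection_def P]
  have inj: "inj_on ((*v) (K + P)) T" for T
    by (rule inj_on_inverseI[where g="(*v) N"]) (simp add: matrix_vector_mul_assoc NM)
  have "(*v) (K + P) ` null_sp K = null_sp K\<^sub>0"
  proof (rule vec.subspace_dim_equal)
    show "(*v) (K + P) ` null_sp K \<subseteq> null_sp K\<^sub>0"
      using p0(3) by (auto simp: matrix_vector_mult_add_rdistrib null_sp_def)
    show "vec.dim ((*v) (K + P) ` null_sp K) \<ge> vec.dim (null_sp K\<^sub>0)"
      using vec.dim_image_eq[OF matrix_vector_mul_linear_gen inj, of "null_sp K"] dim by simp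
  qed (auto intro!: vec.subspace_image subspace_null_sp)
  then have "\<exists>v. K *v v = 0 \<and> P *v w = (K + P) *v v" for w
    using p0(3)[of w] by (force simp: null_sp_def)
  then have "K *v (N *v (P *v w)) = 0" for w
    by (metis NM matrix_vector_mul_assoc matrix_vector_mul_lid)
  then have KNP: "K ** N ** P = 0"
    by (simp add: matrix_eq flip: matrix_vector_mul_assoc)
  have PP: "P ** P = P" unfolding P by (rule null_projection(5)[OF c0])
  then have PP': "P ** (P ** Z) = P ** Z" for Z :: "complex^'N^'N"
    by (simp add: matrix_mul_assoc)
  \<comment> \<open>Multiply \<open>(K + P) ** N = mat 1\<close> by \<open>P\<close> on both the
    right and, with \<open>K ** N ** P = 0\<close>, only \<open>P ** N ** P\<close> survives on the
    left side.\<close>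
  have PNP: "P ** N ** P = P"
    using MN KNP by (metis add_0 matrix_mult.add_left matrix_mul_lid)
  have PNK: "P ** N ** K = 0"
  proof -
    have "P ** N ** (K + P) = P" using NM by (metis matrix_mul_assoc matrix_mul_rid)
    then show ?thesis using PNP by (simp add: matrix_mult.add_right)
  qed
  have a: "?\<pi> ** N ** P = N ** P"
    using null_projection(3)[OF c, of "N ** P"] KNP by (simp add: matrix_mul_assoc)
  have b: "P ** N ** ?\<pi> = P ** N"
    using null_projection(4)[OF c, of "P ** N"] PNK by simp
  have "N ** (K + P) ** ?\<pi> = N ** P ** ?\<pi>"
    by (simp add: matrix_mult.add_left matrix_mult.add_right null_projection(1)[OF c] flip: matrix_mul_assoc)
  then have d: "N ** P ** ?\<pi> = ?\<pi>" by (simp add: NM)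
  have "?\<pi> ** (K + P) ** N = ?\<pi> ** P ** N"
    by (simp add: matrix_mult.add_right null_projection(2)[OF c])
  then have e: "?\<pi> ** P ** N = ?\<pi>" using MN by (metis matrix_mul_assoc matrix_mul_rid)
  \<comment> \<open>\<open>G\<close> is block diagonal for the splitting given by \<open>P\<close>:
    it is \<open>P ** N ** N ** P\<close> on the image of \<open>P\<close> and the identity on its
    null space. The compression \<open>P ** ?\<pi> ** P\<close> inverts the first block.\<close>
  let ?G' = "P ** ?\<pi> ** P + (mat 1 - P)"
  have "P ** N ** N ** P ** (P ** ?\<pi> ** P) = P ** N ** (N ** P ** ?\<pi>) ** P"
    by (simp add: PP' flip: matrix_mul_assoc)
  also have "\<dots> = P" by (simp add: d b PNP)
  finally have GP: "P ** N ** N ** P ** (P ** ?\<pi> ** P) = P" .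
  have PQ: "P ** (mat 1 - P) = 0" "(mat 1 - P) ** P = 0" "(mat 1 - P) ** (mat 1 - P) = mat 1 - P"
    by (simp_all add: matrix_mult.diff_left matrix_mult.diff_right PP)
  have "P ** N ** N ** P ** (mat 1 - P) = 0" "(mat 1 - P) ** (P ** ?\<pi> ** P) = 0"
    using PQ by (metis matrix_mul_assoc matrix_mult.zero_right, metis matrix_mul_assoc matrix_mult.zero_left)
  then have "G ** ?G' = mat 1"
    by (simp add: G_def matrix_mult.add_left matrix_mult.add_right GP PQ)
  \<comment> \<open>Facts \<open>d\<close> and \<open>e\<close> recover \<open>?\<pi>\<close> from
    its compression by \<open>P\<close>, and compressing \<open>?G'\<close> by \<open>P\<close>
    gives the same matrix.\<close>
  moreover have "?\<pi> = N ** P ** ?G' ** P ** N"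
  proof -
    have "P ** ?G' ** P = P ** ?\<pi> ** P"
      using PQ(2) PP PP'
      by (simp add: matrix_mult.add_left matrix_mult.add_right matrix_mult.zero_right
          flip: matrix_mul_assoc)
    then have "N ** P ** ?G' ** P ** N = (N ** P ** ?\<pi>) ** P ** N"
      by (metis matrix_mul_assoc)
    then show ?thesis by (simp add: d e)
  qed
  ultimately show ?thesis by (rule that)
qed

text \<open>Near a point \<open>x\<close>, with \<open>P\<close> frozen at its value there, the
  perturbation formula expresses the projection through \<open>P\<close> and the inverses
  \<open>N\<close> and \<open>G'\<close> of smooth matrix functions. Constancy of the dimension
  makes the formula valid at all nearby points.\<close>

lemma k_smooth_on_null_projection:
  fixes K :: "'e::euclidean_space \<Rightarrow> complex^'N^'N"
  assumes "open S" and K: "k_smooth_on k S K"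
    and c: "\<And>x. x \<in> S \<Longrightarrow> complementary (null_sp (K x)) (range_sp (K x))"
    and dim: "\<And>x. x \<in> S \<Longrightarrow> vec.dim (null_sp (K x)) = m"
  shows "k_smooth_on k S (\<lambda>x. null_projection (K x))"
proof (rule k_smooth_on_local)
  fix x assume "x \<in> S"
  define P where "P = null_projection (K x)"
  define U where "U = {y \<in> S. det (K y + P) \<noteq> 0}"
  have KP: "k_smooth_on k S (\<lambda>y. K y + P)"
    by (intro k_smooth_on_add k_smooth_on_const K \<open>open S\<close>)
  have "k_smooth_on k S (\<lambda>y. det (K y + P))"
    by (intro k_smooth_on_det k_smooth_on_vec_nth KP \<open>open S\<close>)
  then have "continuous_on S (\<lambda>y. det (K y + P))"
    by (rule k_smooth_on_imp_continuous_on)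
  then have "open (S \<inter> (\<lambda>y. det (K y + P)) -` (- {0}))"
    by (intro continuous_open_preimage \<open>open S\<close>) auto
  moreover have "U = S \<inter> (\<lambda>y. det (K y + P)) -` (- {0})" by (auto simp: U_def)
  ultimately have "open U" by simp
  \<comment> \<open>Applying \<open>P\<close> to the equation gives \<open>P *v v = 0\<close>, and
    then \<open>K x *v v = 0\<close>. So \<open>v\<close> lies in the null space, where
    \<open>P\<close> is the identity.\<close>
  have "v = 0" if "(K x + P) *v v = 0" for v
  proof -
    note np = null_projection[OF c[OF \<open>x \<in> S\<close>], folded P_def]
    have "P ** (K x + P) = P" by (simp add: matrix_mult.add_right np)
    then have "P *v v = 0" using that by (metis matrix_vector_mul_assoc matrix_vector_mult_0_right)
    moreover from this have "K x *v v = 0" using that by (simp add: matrix_vector_mult_add_rdistrib)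
    ultimately show ?thesis
      using projection_along(1)[OF subspace_null_sp subspace_range_sp c[OF \<open>x \<in> S\<close>], of v]
      by (simp add: P_def null_projection_def null_sp_def)
  qed
  then have "invertible (K x + P)"
    by (metis invertible_left_inverse matrix_left_invertible_ker)
  then have "x \<in> U"
    using \<open>x \<in> S\<close> by (simp add: U_def invertible_det_nz)
  have "\<forall>y\<in>U. \<exists>N. (K y + P) ** N = mat 1"
    by (metis (mono_tags, lifting) U_def invertible_det_nz invertible_right_inverse mem_Collect_eq)
  \<comment> \<open>This choice, like that of \<open>G'\<close> below, is made pointwise; smoothness
    follows afterwards from \<open>k_smooth_on_matrix_inverse\<close>.\<close>
  then obtain N where N: "\<And>y. y \<in> U \<Longrightarrow> (K y + P) ** N y = mat 1" by metis
  have sN: "k_smooth_on k U N"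
  proof (rule k_smooth_on_matrix_inverse[OF \<open>open U\<close> _ N])
    show "k_smooth_on k U (\<lambda>y. K y + P)"
      by (rule k_smooth_on_subset[OF KP]) (simp add: U_def)
  qed
  let ?G = "\<lambda>y. P ** N y ** N y ** P + (mat 1 - P)"
  have "\<forall>y\<in>U. \<exists>G'. ?G y ** G' = mat 1 \<and> null_projection (K y) = N y ** P ** G' ** P ** N y"
  proof
    fix y assume "y \<in> U"
    then have "y \<in> S" by (simp add: U_def)
    show "\<exists>G'. ?G y ** G' = mat 1 \<and> null_projection (K y) = N y ** P ** G' ** P ** N y"
      using null_projection_perturbation[OF c[OF \<open>y \<in> S\<close>] c[OF \<open>x \<in> S\<close>] _ P_def N[OF \<open>y \<in> U\<close>]]
        dim[OF \<open>x \<in> S\<close>] dim[OF \<open>y \<in> S\<close>] by metis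
  qed
  then obtain G' where G': "\<And>y. y \<in> U \<Longrightarrow> ?G y ** G' y = mat 1"
    "\<And>y. y \<in> U \<Longrightarrow> null_projection (K y) = N y ** P ** G' y ** P ** N y" by metis
  have sG: "k_smooth_on k U ?G"
    by (intro k_smooth_on_add k_smooth_on_bilinear[OF _ bounded_bilinear_matrix_mult]
        k_smooth_on_const sN \<open>open U\<close>)
  have sG': "k_smooth_on k U G'"
    by (rule k_smooth_on_matrix_inverse[OF \<open>open U\<close> sG G'(1)])
  have "k_smooth_on k U (\<lambda>y. N y ** P ** G' y ** P ** N y)"
    by (intro k_smooth_on_bilinear[OF _ bounded_bilinear_matrix_mult]
        k_smooth_on_const sN sG' \<open>open U\<close>)
  then have "k_smooth_on k U (\<lambda>y. null_projection (K y))"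
    by (rule k_smooth_on_cong[OF \<open>open U\<close>]) (simp add: G'(2))
  with \<open>open U\<close> \<open>x \<in> U\<close> show "\<exists>U. open U \<and> x \<in> U \<and> k_smooth_on k U (\<lambda>x. null_projection (K x))"
    by blast
qed

section \<open>Differentials on manifolds\<close>

lemma open_chart_image:
  assumes "smooth_manifold X A" "c \<in> A"
  shows "open (snd c ` fst c)"
  using assms by (auto simp: smooth_manifold_def is_chart_def)

lemma chart_domain_subset:
  assumes "smooth_manifold X A" "c \<in> A"
  shows "fst c \<subseteq> topspace X"
  using assms by (auto simp: smooth_manifold_def)

section \<open>Smooth maps in charts\<close>

lemma smooth_map_k_smooth_on:
  "smooth_map A f \<Longrightarrow> c \<in> A \<Longrightarrow> k_smooth_on k (snd c ` fst c) (\<lambda>y. f (chart_inv c y))"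
  by (simp add: smooth_map_def smooth_on_def o_def)

lemma smooth_mapI:
  "(\<And>c k. c \<in> A \<Longrightarrow> k_smooth_on k (snd c ` fst c) (\<lambda>y. f (chart_inv c y))) \<Longrightarrow> smooth_map A f"
  by (simp add: smooth_map_def smooth_on_def o_def)

lemma smooth_map_const: "smooth_manifold X A \<Longrightarrow> smooth_map A (\<lambda>p. v)"
  by (rule smooth_mapI) (rule k_smooth_on_const[OF open_chart_image])

lemma smooth_map_bounded_linear:
  assumes "smooth_manifold X A" "bounded_linear L" "smooth_map A f"
  shows "smooth_map A (\<lambda>p. L (f p))"
proof (rule smooth_mapI)
  fix c k assume c: "c \<in> A"
  show "k_smooth_on k (snd c ` fst c) (\<lambda>y. L (f (chart_inv c y)))"
    by (rule k_smooth_on_bounded_linear[OF open_chart_image[OF assms(1) c] assms(2)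
          smooth_map_k_smooth_on[OF assms(3) c]])
qed

lemma smooth_map_bilinear:
  assumes "smooth_manifold X A" "bounded_bilinear B" "smooth_map A f" "smooth_map A g"
  shows "smooth_map A (\<lambda>p. B (f p) (g p))"
proof (rule smooth_mapI)
  fix c k assume c: "c \<in> A"
  show "k_smooth_on k (snd c ` fst c) (\<lambda>y. B (f (chart_inv c y)) (g (chart_inv c y)))"
    by (rule k_smooth_on_bilinear[OF open_chart_image[OF assms(1) c] assms(2)
          smooth_map_k_smooth_on[OF assms(3) c] smooth_map_k_smooth_on[OF assms(4) c]])
qed

lemma smooth_map_diff:
  assumes "smooth_manifold X A" "smooth_map A f" "smooth_map A g"
  shows "smooth_map A (\<lambda>p. f p - g p)"
proof (rule smooth_mapI)
  fix c k assume c: "c \<in> A"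
  show "k_smooth_on k (snd c ` fst c) (\<lambda>y. f (chart_inv c y) - g (chart_inv c y))"
    by (rule k_smooth_on_diff[OF open_chart_image[OF assms(1) c]
          smooth_map_k_smooth_on[OF assms(2) c] smooth_map_k_smooth_on[OF assms(3) c]])
qed

section \<open>Differentiation rules in a chart\<close>

lemma differential_eqI:
  "((f \<circ> chart_inv c) has_derivative D) (at (snd c p)) \<Longrightarrow> differential f c p h = D h"
  unfolding differential_def by (metis frechet_derivative_at)

lemma differential_has_derivative:
  "(f \<circ> chart_inv c) differentiable (at (snd c p)) \<Longrightarrow>
    ((\<lambda>y. f (chart_inv c y)) has_derivative differential f c p) (at (snd c p))"
  by (simp add: frechet_derivative_works differential_def[abs_def] o_def)

text \<open>The chart image is open, so agreement on the chart domain determines the differential.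
  This allows identities valid on \<open>topspace X\<close>, such as idempotence of the projection,
  to be differentiated.\<close>

lemma differential_cong:
  assumes M: "smooth_manifold X A" and c: "c \<in> A" "p \<in> fst c"
    and f: "(f \<circ> chart_inv c) differentiable (at (snd c p))"
    and eq: "\<And>q. q \<in> fst c \<Longrightarrow> f q = g q"
  shows "differential f c p h = differential g c p h"
proof -
  have "frechet_derivative (f \<circ> chart_inv c) (at (snd c p)) =
      frechet_derivative (g \<circ> chart_inv c) (at (snd c p))"
    using c eq by (intro frechet_derivative_transform_within_open[OF f open_chart_image[OF M]])
      (auto simp: chart_inv_left[OF M])
  then show ?thesis by (simp add: differential_def)
qed

lemma differential_const: "differential (\<lambda>q. v) c p h = 0"
  by (rule differential_eqI) (simp add: o_def)

lemma differential_bounded_linear: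
  assumes "bounded_linear L" "(f \<circ> chart_inv c) differentiable (at (snd c p))"
  shows "differential (\<lambda>q. L (f q)) c p h = L (differential f c p h)"
  by (rule differential_eqI)
    (simp add: o_def bounded_linear.has_derivative[OF assms(1) differential_has_derivative[OF assms(2)]])

lemma differential_bilinear:
  assumes M: "smooth_manifold X A" and c: "c \<in> A" "p \<in> fst c" and B: "bounded_bilinear B"
    and f: "(f \<circ> chart_inv c) differentiable (at (snd c p))"
    and g: "(g \<circ> chart_inv c) differentiable (at (snd c p))"
  shows "differential (\<lambda>q. B (f q) (g q)) c p h =
    B (f p) (differential g c p h) + B (differential f c p h) (g p)"
proof (rule differential_eqI)
  show "((\<lambda>q. B (f q) (g q)) \<circ> chart_inv c has_derivative
      (\<lambda>h. B (f p) (differential g c p h) + B (differential f c p h) (g p))) (at (snd c p))"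
    using bounded_bilinear.FDERIV[OF B differential_has_derivative[OF f] differential_has_derivative[OF g]]
    by (simp add: o_def chart_inv_left[OF M c])
qed

text \<open>The coordinate vector fields of a chart commute.\<close>

lemma differential_differential:
  fixes f :: "'p \<Rightarrow> 'v::euclidean_space"
  assumes M: "smooth_manifold X A" and c: "c \<in> A" "p \<in> fst c" and f: "smooth_map A f"
  shows "((\<lambda>q. differential f c q k) \<circ> chart_inv c) differentiable (at (snd c p))"
    and "differential (\<lambda>q. differential f c q k) c p h = differential (\<lambda>q. differential f c q h) c p k"
proof -
  let ?S = "snd c ` fst c" and ?D = "\<lambda>k y. frechet_derivative (f \<circ> chart_inv c) (at y) k"
  have k: "k_smooth_on (Suc (Suc 0)) ?S (f \<circ> chart_inv c)"
    using f c(1) unfolding smooth_map_def smooth_on_def by blast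
  have p: "snd c p \<in> ?S" using c by simp
  \<comment> \<open>Read in the chart, the differential is a directional derivative on the open
    chart image, which brings the claim down to Schwarz's theorem in Euclidean space.\<close>
  have eq: "((\<lambda>q. differential f c q k) \<circ> chart_inv c) y = ?D k y" if "y \<in> ?S" for y k
    using that by (auto simp: differential_def chart_inv_left[OF M c(1)])
  have d: "?D k differentiable (at (snd c p))" for k
    using k p unfolding k_smooth_on.simps by blast
  obtain D where "(?D k has_derivative D) (at (snd c p))"
    using d[of k] by (auto simp: differentiable_def)
  then have "(((\<lambda>q. differential f c q k) \<circ> chart_inv c) has_derivative D) (at (snd c p))"
    by (rule has_derivative_transform_within_open[OF _ open_chart_image[OF M c(1)] p]) (simp only: eq)
  then show "((\<lambda>q. differential f c q k) \<circ> chart_inv c) differentiable (at (snd c p))"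
    by (auto simp: differentiable_def)
  have fd: "frechet_derivative ((\<lambda>q. differential f c q k) \<circ> chart_inv c) (at (snd c p)) =
      frechet_derivative (?D k) (at (snd c p))" for k
    using eq
    by (intro frechet_derivative_transform_within_open[OF d[of k] open_chart_image[OF M c(1)] p, symmetric]) simp
  have "frechet_derivative (?D k) (at (snd c p)) h = frechet_derivative (?D h) (at (snd c p)) k"
    by (rule mixed_derivatives_commute[OF open_chart_image[OF M c(1)] p k])
  then show "differential (\<lambda>q. differential f c q k) c p h = differential (\<lambda>q. differential f c q h) c p k"
    unfolding differential_def[of "\<lambda>q. differential f c q _"] fd .
qed

lemma chart_at:
  assumes "smooth_manifold X A" "p \<in> topspace X"
  shows "chart_at A p \<in> A" "p \<in> fst (chart_at A p)"
proof -
  have "p \<in> (\<Union>c\<in>A. fst c)"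
    using assms unfolding smooth_manifold_def by blast
  then have "\<exists>c. c \<in> A \<and> p \<in> fst c" by blast
  from someI_ex[OF this] show "chart_at A p \<in> A" "p \<in> fst (chart_at A p)"
    by (simp_all add: chart_at_def)
qed

text \<open>Differentials commute with taking entries. Moving the sum over the inner matrix index
  inside the sums over coordinate directions turns it into a matrix product.\<close>

lemma matrix_bracket_eq:
  fixes a b :: "'p \<Rightarrow> complex^'N^'N"
  assumes M: "smooth_manifold X A" and a: "smooth_map A a" and b: "smooth_map A b"
    and p: "p \<in> topspace X"
  defines "c \<equiv> chart_at A p"
  shows "matrix_bracket A \<Pi>\<^sub>P a b p =
    (\<Sum>i\<in>Basis. \<Sum>j\<in>Basis. \<Pi>\<^sub>P c p i j *\<^sub>R (differential a c p i ** differential b c p j))"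
proof -
  note c = chart_at[OF M p, folded c_def]
  have d: "differential (\<lambda>q. f q $ r $ s) c p h = differential f c p h $ r $ s"
    if "smooth_map A f" for f :: "'p \<Rightarrow> complex^'N^'N" and r s h
    by (rule differential_bounded_linear[OF _ smooth_map_differentiable[OF that c]])
      (rule bounded_linear_compose[OF bounded_linear_vec_nth bounded_linear_vec_nth])
  have "matrix_bracket A \<Pi>\<^sub>P a b p $ r $ s =
      (\<Sum>k\<in>UNIV. \<Sum>i\<in>Basis. \<Sum>j\<in>Basis. \<Pi>\<^sub>P c p i j *\<^sub>R (differential a c p i $ r $ k * differential b c p j $ k $ s))"
    for r s
    by (simp add: matrix_bracket_def poisson_bracket_def Let_def d[OF a] d[OF b] flip: c_def)
  also have "\<dots> r s = (\<Sum>i\<in>Basis. \<Sum>k\<in>UNIV. \<Sum>j\<in>Basis.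
      \<Pi>\<^sub>P c p i j *\<^sub>R (differential a c p i $ r $ k * differential b c p j $ k $ s))" for r s
    by (rule sum.swap)
  also have "\<dots> r s = (\<Sum>i\<in>Basis. \<Sum>j\<in>Basis. \<Sum>k\<in>UNIV.
      \<Pi>\<^sub>P c p i j *\<^sub>R (differential a c p i $ r $ k * differential b c p j $ k $ s))" for r s
    by (intro sum.cong refl sum.swap)
  finally show ?thesis
    by (simp add: vec_eq_iff matrix_matrix_mult_def scaleR_sum_right)
qed

section \<open>Geometry of the image bundle of a projection\<close>

text \<open>Connection, curvature and the two second fundamental forms depend on the projection
  alone, so they are computed for an arbitrary smooth family of projections.\<close>

locale smooth_projection =
  fixes X :: "'p topology" and A :: "('p, 'e::euclidean_space) chart set"
    and \<pi> :: "'p \<Rightarrow> complex^'N^'N"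
  assumes manifold: "smooth_manifold X A"
    and smooth: "smooth_map A \<pi>"
    and idem: "p \<in> topspace X \<Longrightarrow> \<pi> p ** \<pi> p = \<pi> p"
begin

lemma smooth_apply: "smooth_map A \<zeta> \<Longrightarrow> smooth_map A (\<lambda>q. \<pi> q *v \<zeta> q)"
  using smooth_map_bilinear[OF manifold bounded_bilinear_matrix_vector_mult] smooth by blast

lemma E_sections_iff:
  "\<zeta> \<in> E_sections X A \<pi> \<longleftrightarrow> smooth_map A \<zeta> \<and> (\<forall>p\<in>topspace X. \<pi> p *v \<zeta> p = \<zeta> p)"
proof -
  have "v \<in> range_sp (\<pi> p) \<longleftrightarrow> \<pi> p *v v = v" if "p \<in> topspace X" for p v
    using idem[OF that] by (auto simp: range_sp_def image_iff matrix_vector_mul_assoc dest: sym)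
  then show ?thesis by (auto simp: E_sections_def)
qed

lemma apply_E_section: "(\<lambda>q. \<pi> q *v v) \<in> E_sections X A \<pi>"
  by (simp add: E_sections_iff matrix_vector_mul_assoc idem smooth_apply
      smooth_map_const[OF manifold])

lemma apply_Eperp_section: "(\<lambda>q. v - \<pi> q *v v) \<in> Eperp_sections X A \<pi>"
  by (simp add: Eperp_sections_def null_sp_def vec.diff matrix_vector_mul_assoc idem smooth_apply
      smooth_map_const[OF manifold] smooth_map_diff[OF manifold])

context
  fixes c :: "('p, 'e) chart" and p :: 'p
  assumes c: "c \<in> A" "p \<in> fst c"
begin

lemma idem_at: "\<pi> p ** \<pi> p = \<pi> p"
  using idem chart_domain_subset[OF manifold c(1)] c(2) by blast

lemma idem_at': "\<pi> p ** (\<pi> p ** Z) = \<pi> p ** Z"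
  by (simp add: matrix_mul_assoc idem_at)

abbreviation "d h \<equiv> differential \<pi> c p h"

lemma differential_projection: "d h = \<pi> p ** d h + d h ** \<pi> p"
proof -
  have *: "(\<pi> \<circ> chart_inv c) differentiable (at (snd c p))"
    by (rule smooth_map_differentiable[OF smooth c])
  have "d h = differential (\<lambda>q. \<pi> q ** \<pi> q) c p h"
    using idem chart_domain_subset[OF manifold c(1)]
    by (intro differential_cong[OF manifold c *]) auto
  then show ?thesis
    by (simp add: differential_bilinear[OF manifold c bounded_bilinear_matrix_mult * *])
qed

text \<open>Multiplying \<open>differential_projection\<close> by \<open>\<pi> p\<close> on the left
  produces \<open>\<pi> p ** d h\<close> on both sides; the remaining term must vanish. So
  \<open>d h\<close> has no component from the image to the image.\<close>

lemma projection_differential_projection: "\<pi> p ** (d h ** \<pi> p) = 0"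
proof -
  have "\<pi> p ** d h = \<pi> p ** (\<pi> p ** d h + d h ** \<pi> p)"
    using differential_projection[of h] by simp
  then show ?thesis
    by (simp add: matrix_mult.add_right idem_at')
qed

lemma differential_apply:
  assumes "(\<zeta> \<circ> chart_inv c) differentiable (at (snd c p))"
  shows "differential (\<lambda>q. \<pi> q *v \<zeta> q) c p h = \<pi> p *v differential \<zeta> c p h + d h *v \<zeta> p"
  by (rule differential_bilinear[OF manifold c bounded_bilinear_matrix_vector_mult
      smooth_map_differentiable[OF smooth c] assms])

text \<open>Leibniz rule for \<open>\<zeta> = \<pi> \<zeta>\<close>. The part of the differential
  left after subtracting its projection depends only on the value of \<open>\<zeta>\<close> at
  \<open>p\<close>, which is what makes \<open>second_fund\<close> a form.\<close>

lemma differential_E_section: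
  assumes "\<zeta> \<in> E_sections X A \<pi>"
  shows "differential \<zeta> c p h = \<pi> p *v differential \<zeta> c p h + d h *v \<zeta> p"
proof -
  have \<zeta>: "smooth_map A \<zeta>" "\<forall>p\<in>topspace X. \<pi> p *v \<zeta> p = \<zeta> p" using assms by (auto simp: E_sections_iff)
  have *: "(\<zeta> \<circ> chart_inv c) differentiable (at (snd c p))"
    by (rule smooth_map_differentiable[OF \<zeta>(1) c])
  have "differential \<zeta> c p h = differential (\<lambda>q. \<pi> q *v \<zeta> q) c p h"
    using \<zeta>(2) chart_domain_subset[OF manifold c(1)]
    by (intro differential_cong[OF manifold c *]) auto
  then show ?thesis by (simp add: differential_apply[OF *])
qed

text \<open>Leibniz rule for \<open>\<pi> \<eta> = 0\<close>; the dual tensoriality statement,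
  behind \<open>second_fund_star\<close>.\<close>

lemma differential_Eperp_section:
  assumes "\<eta> \<in> Eperp_sections X A \<pi>"
  shows "\<pi> p *v differential \<eta> c p h = - (d h *v \<eta> p)"
proof -
  have \<eta>: "smooth_map A \<eta>" "\<forall>p\<in>topspace X. \<pi> p *v \<eta> p = 0"
    using assms by (auto simp: Eperp_sections_def null_sp_def)
  have *: "(\<eta> \<circ> chart_inv c) differentiable (at (snd c p))"
    by (rule smooth_map_differentiable[OF \<eta>(1) c])
  have "differential (\<lambda>q. \<pi> q *v \<eta> q) c p h = differential (\<lambda>q. 0) c p h"
    using \<eta>(2) chart_domain_subset[OF manifold c(1)]
    by (intro differential_cong[OF manifold c smooth_map_differentiable[OF smooth_apply[OF \<eta>(1)] c]]) auto
  then show ?thesis by (simp add: differential_apply[OF *] differential_const eq_neg_iff_add_eq_0)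
qed

lemma E_section_at: "\<zeta> \<in> E_sections X A \<pi> \<Longrightarrow> \<pi> p *v \<zeta> p = \<zeta> p"
  using chart_domain_subset[OF manifold c(1)] c(2) by (auto simp: E_sections_iff)

text \<open>Uniqueness for the definite descriptions. The sections \<open>\<pi> v\<close> fill the
  fibre at \<open>p\<close>, and the right factor \<open>\<pi> p\<close> makes both matrices vanish
  on the complement. The free left factors let one lemma serve both \<open>second_fund\<close> and
  \<open>curvature\<close>.\<close>

lemma hom_from_E_eqI:
  assumes "M = Q ** M ** \<pi> p" "N = R ** N ** \<pi> p"
    and eq: "\<And>\<zeta>. \<zeta> \<in> E_sections X A \<pi> \<Longrightarrow> M *v \<zeta> p = N *v \<zeta> p"
  shows "M = N"
proof -
  have "(M ** \<pi> p) *v v = (N ** \<pi> p) *v v" for v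
    using eq[OF apply_E_section[of v]] by (simp add: matrix_vector_mul_assoc)
  then have "M ** \<pi> p = N ** \<pi> p" by (simp add: matrix_eq)
  moreover have "M ** \<pi> p = M" "N ** \<pi> p = N"
    by (subst (1 2) assms, simp add: idem_at flip: matrix_mul_assoc)+
  ultimately show ?thesis by simp
qed

lemma hom_from_Eperp_eqI:
  assumes "M = Q ** M ** (mat 1 - \<pi> p)" "N = R ** N ** (mat 1 - \<pi> p)"
    and eq: "\<And>\<eta>. \<eta> \<in> Eperp_sections X A \<pi> \<Longrightarrow> M *v \<eta> p = N *v \<eta> p"
  shows "M = N"
proof -
  have "(M ** (mat 1 - \<pi> p)) *v v = (N ** (mat 1 - \<pi> p)) *v v" for v
    using eq[OF apply_Eperp_section[of v]]
    by (simp add: matrix_vector_mult_diff_rdistrib flip: matrix_vector_mul_assoc)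
  then have "M ** (mat 1 - \<pi> p) = N ** (mat 1 - \<pi> p)" by (simp add: matrix_eq)
  moreover have "(mat 1 - \<pi> p) ** (mat 1 - \<pi> p) = mat 1 - \<pi> p"
    by (simp add: matrix_mult.diff_left matrix_mult.diff_right idem_at)
  then have "M ** (mat 1 - \<pi> p) = M" "N ** (mat 1 - \<pi> p) = N"
    by (subst (1 2) assms, simp flip: matrix_mul_assoc)+
  ultimately show ?thesis by simp
qed

section \<open>Second fundamental forms and curvature in terms of \<open>d\<close>\<close>

lemma second_fund_eq: "second_fund X A \<pi> c p h = d h ** \<pi> p"
  unfolding second_fund_def
proof (rule the_equality)
  let ?M = "d h ** \<pi> p"
  have M: "?M = (mat 1 - \<pi> p) ** ?M ** \<pi> p"
    by (simp add: matrix_mult.diff_left projection_differential_projection idem_at flip: matrix_mul_assoc)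
  moreover have S: "?M *v \<zeta> p = (mat 1 - \<pi> p) *v differential \<zeta> c p h"
    if "\<zeta> \<in> E_sections X A \<pi>" for \<zeta>
  proof -
    have "d h *v \<zeta> p = differential \<zeta> c p h - \<pi> p *v differential \<zeta> c p h"
      using differential_E_section[OF that, of h] by (metis add_diff_cancel_left')
    then show ?thesis
      by (simp add: E_section_at[OF that] matrix_vector_mult_diff_rdistrib flip: matrix_vector_mul_assoc)
  qed
  ultimately show "?M = (mat 1 - \<pi> p) ** ?M ** \<pi> p \<and>
      (\<forall>\<zeta>\<in>E_sections X A \<pi>. ?M *v \<zeta> p = (mat 1 - \<pi> p) *v differential \<zeta> c p h)"
    by blast
  fix M assume "M = (mat 1 - \<pi> p) ** M ** \<pi> p \<and>
    (\<forall>\<zeta>\<in>E_sections X A \<pi>. M *v \<zeta> p = (mat 1 - \<pi> p) *v differential \<zeta> c p h)"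
  then show "M = ?M"
    by (intro hom_from_E_eqI[OF _ M]) (auto simp: S)
qed

lemma second_fund_star_eq: "second_fund_star X A \<pi> c p h = \<pi> p ** d h"
  unfolding second_fund_star_def
proof (rule the_equality)
  let ?M = "\<pi> p ** d h"
  have M: "?M = \<pi> p ** ?M ** (mat 1 - \<pi> p)"
    by (simp add: matrix_mult.diff_right projection_differential_projection idem_at' flip: matrix_mul_assoc)
  moreover have S: "?M *v \<eta> p = - (\<pi> p *v differential \<eta> c p h)"
    if "\<eta> \<in> Eperp_sections X A \<pi>" for \<eta>
  proof -
    have "d h *v \<eta> p = - (\<pi> p *v differential \<eta> c p h)"
      using differential_Eperp_section[OF that, of h] by simp
    then show ?thesis
      by (simp add: vec.neg matrix_vector_mul_assoc idem_at flip: matrix_vector_mul_assoc[of _ "d h"])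
  qed
  ultimately show "?M = \<pi> p ** ?M ** (mat 1 - \<pi> p) \<and>
      (\<forall>\<eta>\<in>Eperp_sections X A \<pi>. ?M *v \<eta> p = - (\<pi> p *v differential \<eta> c p h))"
    by blast
  fix M assume "M = \<pi> p ** M ** (mat 1 - \<pi> p) \<and>
    (\<forall>\<eta>\<in>Eperp_sections X A \<pi>. M *v \<eta> p = - (\<pi> p *v differential \<eta> c p h))"
  then show "M = ?M"
    by (intro hom_from_Eperp_eqI[OF _ M]) (auto simp: S)
qed

text \<open>In the Leibniz expansion \<open>\<pi> p ** d h\<close> meets the differential of
  \<open>\<zeta>\<close>. It kills the part in the image of \<open>\<pi> p\<close>, leaving
  \<open>d k *v \<zeta> p\<close> by \<open>differential_E_section\<close>.\<close>

lemma proj_connection_proj_connection: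
  assumes \<zeta>: "\<zeta> \<in> E_sections X A \<pi>"
  shows "proj_connection \<pi> (\<lambda>q. proj_connection \<pi> \<zeta> c q k) c p h =
    \<pi> p *v differential (\<lambda>q. differential \<zeta> c q k) c p h + (\<pi> p ** d h ** d k) *v \<zeta> p"
proof -
  have "smooth_map A \<zeta>" using \<zeta> by (simp add: E_sections_def)
  note dd = differential_differential(1)[OF manifold c this, of k]
  have "(\<pi> p ** d h) *v (\<pi> p *v differential \<zeta> c p k) = 0"
    by (simp add: matrix_vector_mul_assoc projection_differential_projection flip: matrix_mul_assoc)
  then have "(\<pi> p ** d h) *v differential \<zeta> c p k = (\<pi> p ** d h) *v (d k *v \<zeta> p)"
    by (subst differential_E_section[OF \<zeta>]) (simp add: vec.add)
  then show ?thesis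
    unfolding proj_connection_def differential_apply[OF dd]
    by (simp add: vec.add matrix_vector_mul_assoc idem_at)
qed

text \<open>Antisymmetrizing in \<open>h\<close> and \<open>k\<close> cancels the second derivatives
  of \<open>\<zeta>\<close>, so only the commutator of \<open>d h\<close> and \<open>d k\<close>,
  compressed by \<open>\<pi> p\<close>, remains.\<close>

lemma curvature_eq: "curvature X A \<pi> c p h k = \<pi> p ** (d h ** d k - d k ** d h) ** \<pi> p"
  unfolding curvature_def
proof (rule the_equality)
  let ?M = "\<pi> p ** (d h ** d k - d k ** d h) ** \<pi> p"
  have M: "?M = \<pi> p ** ?M ** \<pi> p"
    by (simp add: idem_at idem_at' flip: matrix_mul_assoc)
  moreover have S: "cov_ext_derivative \<pi> (proj_connection \<pi> \<zeta>) c p h k = ?M *v \<zeta> p"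
    if "\<zeta> \<in> E_sections X A \<pi>" for \<zeta>
  proof -
    have "smooth_map A \<zeta>" using that by (simp add: E_sections_def)
    note dd = differential_differential(2)[OF manifold c this, of k h]
    have "?M *v \<zeta> p = (\<pi> p ** d h ** d k) *v \<zeta> p - (\<pi> p ** d k ** d h) *v \<zeta> p"
      by (simp add: E_section_at[OF that] matrix_vector_mult_diff_rdistrib vec.diff
          flip: matrix_vector_mul_assoc)
    then show ?thesis
      unfolding cov_ext_derivative_def proj_connection_proj_connection[OF that] dd by simp
  qed
  ultimately show "?M = \<pi> p ** ?M ** \<pi> p \<and> (\<forall>\<zeta>\<in>E_sections X A \<pi>.
      cov_ext_derivative \<pi> (proj_connection \<pi> \<zeta>) c p h k = ?M *v \<zeta> p)"
    by blast
  fix M assume "M = \<pi> p ** M ** \<pi> p \<and> (\<forall>\<zeta>\<in>E_sections X A \<pi>.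
      cov_ext_derivative \<pi> (proj_connection \<pi> \<zeta>) c p h k = M *v \<zeta> p)"
  then show "M = ?M"
    by (intro hom_from_E_eqI[OF _ M]) (auto simp: S)
qed

end

end

section \<open>The bracket formula\<close>

theorem mainTheorem2:
  fixes X :: "'p topology"
    and A :: "('p, 'e::euclidean_space) chart set"
    and \<Pi>\<^sub>P :: "('p, 'e) bivector"
    and H\<^sub>0 :: "'p \<Rightarrow> complex^'N^'N"
    and lam :: "'p \<Rightarrow> complex"
  assumes "poisson_manifold X A \<Pi>\<^sub>P"
    and "smooth_map A H\<^sub>0"
    and "regular_eigenvalue_function X A H\<^sub>0 lam"
  defines "\<pi>\<^sub>0 \<equiv> eigenprojection H\<^sub>0 lam"
  defines "F \<equiv> curvature X A \<pi>\<^sub>0"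
    and "S \<equiv> second_fund X A \<pi>\<^sub>0"
    and "S_star \<equiv> second_fund_star X A \<pi>\<^sub>0"
  shows "\<forall>x\<in>topspace X.
    \<pi>\<^sub>0 x ** matrix_bracket A \<Pi>\<^sub>P \<pi>\<^sub>0 (\<lambda>y. H\<^sub>0 y - mat (lam y)) x ** \<pi>\<^sub>0 x =
    mat (lam x) ** contraction A \<Pi>\<^sub>P F x
    - contraction A \<Pi>\<^sub>P
        (wedge S_star (\<lambda>c y h. (H\<^sub>0 y - mat (lam y) ** \<pi>\<^sub>0 y) ** S c y h)) x"
proof
  fix x assume x: "x \<in> topspace X"
  define K where "K y = H\<^sub>0 y - mat (lam y)" for y
  have M: "smooth_manifold X A" and B: "bivector_field A \<Pi>\<^sub>P"
    using assms(1) by (auto simp: poisson_manifold_def)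
  have \<pi>\<^sub>0: "\<pi>\<^sub>0 = (\<lambda>y. null_projection (K y))"
    by (simp add: \<pi>\<^sub>0_def eigenprojection_def null_projection_def K_def fun_eq_iff)
  from assms(3) obtain m where lam: "smooth_map A lam"
    and dim: "\<And>y. y \<in> topspace X \<Longrightarrow> vec.dim (null_sp (K y)) = m"
    and compl: "\<And>y. y \<in> topspace X \<Longrightarrow> complementary (null_sp (K y)) (range_sp (K y))"
    by (auto simp: regular_eigenvalue_function_def K_def)
  have K: "smooth_map A K"
    unfolding K_def[abs_def]
    by (intro smooth_map_diff[OF M] smooth_map_bounded_linear[OF M bounded_linear_mat] assms(2) lam)
  have chart_in: "chart_inv c y \<in> topspace X" if "c \<in> A" "y \<in> snd c ` fst c" for c y
    using that chart_domain_subset[OF M that(1)] by (auto simp: chart_inv_left[OF M that(1)])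
  have "smooth_map A \<pi>\<^sub>0"
    unfolding \<pi>\<^sub>0
  proof (rule smooth_mapI)
    fix c k assume c: "c \<in> A"
    show "k_smooth_on k (snd c ` fst c) (\<lambda>y. null_projection (K (chart_inv c y)))"
      by (rule k_smooth_on_null_projection[OF open_chart_image[OF M c] smooth_map_k_smooth_on[OF K c]
            compl[OF chart_in[OF c]] dim[OF chart_in[OF c]]])
  qed
  then interpret smooth_projection X A \<pi>\<^sub>0
    using M null_projection(5)[OF compl] by unfold_locales (auto simp: \<pi>\<^sub>0)

  define c where "c = chart_at A x"
  note c = chart_at[OF M x, folded c_def]
  define P where "P = \<pi>\<^sub>0 x"
  define L where "L = K x"
  define d where "d = differential \<pi>\<^sub>0 c x"
  define e where "e = differential K c x"
  have KP: "K q ** \<pi>\<^sub>0 q = 0" if "q \<in> fst c" for q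
    using null_projection(1)[OF compl] chart_domain_subset[OF M c(1)] that by (auto simp: \<pi>\<^sub>0)
  \<comment> \<open>The Leibniz rule at \<open>x\<close> for \<open>K \<pi>\<^sub>0 = 0\<close>, an
    identity on the whole chart domain.\<close>
  have "L ** d j + e j ** P = 0" for j
  proof -
    have sm: "smooth_map A (\<lambda>q. K q ** \<pi>\<^sub>0 q)"
      using smooth_map_bilinear[OF M bounded_bilinear_matrix_mult] K smooth by blast
    have "differential (\<lambda>q. K q ** \<pi>\<^sub>0 q) c x j = differential (\<lambda>q. 0) c x j"
      by (rule differential_cong[OF M c smooth_map_differentiable[OF sm c]]) (rule KP)
    then show ?thesis
      using differential_bilinear[OF M c bounded_bilinear_matrix_mult
          smooth_map_differentiable[OF K c] smooth_map_differentiable[OF smooth c], of j]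
      by (simp add: differential_const L_def d_def e_def P_def)
  qed
  then have eP: "e j ** P = - (L ** d j)" for j
    by (simp add: eq_neg_iff_add_eq_0 add.commute)
  have dP: "d j = P ** d j + d j ** P" and PdP: "P ** (d j ** P) = 0" and PP: "P ** P = P" for j
    unfolding d_def P_def
    by (rule differential_projection[OF c] projection_differential_projection[OF c] idem_at[OF c])+
  have LP: "L ** P = 0" unfolding L_def P_def by (rule KP[OF c(2)])
  \<comment> \<open>Since \<open>L\<close> kills \<open>P\<close>, only the summand
    \<open>d j ** P\<close> of \<open>d j\<close> survives, and this is the value of
    \<open>S\<close>.\<close>
  have "L ** d j = L ** (P ** d j + d j ** P)" for j using dP[of j] by simp
  then have Ld: "L ** d j = L ** (d j ** P)" for j
    by (simp add: matrix_mult.add_right matrix_mul_assoc LP matrix_mult.zero_left)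
  \<comment> \<open>On the values of \<open>S\<close> the factor \<open>mat 1 - P\<close> is the
    identity, so there the endomorphism in the theorem is \<open>L\<close> shifted by the
    eigenvalue.\<close>
  have H: "H\<^sub>0 x - mat (lam x) ** P = L + mat (lam x) ** (mat 1 - P)"
    by (simp add: L_def K_def matrix_mult.diff_right)
  \<comment> \<open>The theorem before contraction, for one pair of coordinate directions.\<close>
  have term_eq: "P ** (d i ** e j) ** P =
      mat (lam x) ** (P ** d i ** (d j ** P)) -
      P ** d i ** ((H\<^sub>0 x - mat (lam x) ** P) ** (d j ** P))" for i j
  proof -
    have "(mat 1 - P) ** (d j ** P) = d j ** P"
      by (simp add: matrix_mult.diff_left PdP)
    then have "(H\<^sub>0 x - mat (lam x) ** P) ** (d j ** P) = L ** (d j ** P) + mat (lam x) ** (d j ** P)"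
      unfolding H by (simp add: matrix_mult.add_left flip: matrix_mul_assoc)
    moreover have "P ** d i ** (mat (lam x) ** (d j ** P)) = mat (lam x) ** (P ** d i ** (d j ** P))"
      by (simp add: matrix_mul_assoc mat_mult_commute) (simp add: mat_mult_commute flip: matrix_mul_assoc)
    moreover have "P ** (d i ** e j) ** P = - (P ** d i ** (L ** (d j ** P)))"
      by (simp add: eP Ld matrix_mult.minus_right flip: matrix_mul_assoc)
    ultimately show ?thesis by (simp add: matrix_mult.add_right)
  qed
  \<comment> \<open>A contraction at \<open>x\<close> only reads the form in the chart
    \<open>c\<close> at \<open>x\<close>, so the local formulas suffice to replace \<open>F\<close>
    by the wedge product of \<open>S_star\<close> and \<open>S\<close>.\<close>
  have "contraction A \<Pi>\<^sub>P F x = contraction A \<Pi>\<^sub>P (wedge S_star S) x"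
    by (simp add: contraction_def Let_def wedge_def F_def S_def S_star_def curvature_eq[OF c]
        second_fund_eq[OF c] second_fund_star_eq[OF c] matrix_mult.diff_left matrix_mult.diff_right
        matrix_mul_assoc flip: c_def)
  \<comment> \<open>Skewness of the bivector merges the two halves of the wedge product and absorbs
    the factor 1/2.\<close>
  then have F: "contraction A \<Pi>\<^sub>P F x =
      (\<Sum>i\<in>Basis. \<Sum>j\<in>Basis. \<Pi>\<^sub>P c x i j *\<^sub>R (P ** d i ** (d j ** P)))"
    by (simp add: contraction_wedge[OF B c] Let_def S_def S_star_def second_fund_eq[OF c]
        second_fund_star_eq[OF c] P_def d_def flip: c_def)
  have S: "contraction A \<Pi>\<^sub>P (wedge S_star (\<lambda>c y h. (H\<^sub>0 y - mat (lam y) ** \<pi>\<^sub>0 y) ** S c y h)) x =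
      (\<Sum>i\<in>Basis. \<Sum>j\<in>Basis. \<Pi>\<^sub>P c x i j *\<^sub>R (P ** d i ** ((H\<^sub>0 x - mat (lam x) ** P) ** (d j ** P))))"
    by (simp add: contraction_wedge[OF B c] Let_def S_def S_star_def second_fund_eq[OF c]
        second_fund_star_eq[OF c] P_def d_def flip: c_def)
  have "P ** matrix_bracket A \<Pi>\<^sub>P \<pi>\<^sub>0 K x ** P =
      (\<Sum>i\<in>Basis. \<Sum>j\<in>Basis. \<Pi>\<^sub>P c x i j *\<^sub>R (P ** (d i ** e j) ** P))"
    by (simp add: matrix_bracket_eq[OF M smooth K x] matrix_mult.sum_left matrix_mult.sum_right
        matrix_mult.scaleR_left matrix_mult.scaleR_right d_def e_def flip: c_def)
  also have "\<dots> = mat (lam x) ** contraction A \<Pi>\<^sub>P F x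
    - contraction A \<Pi>\<^sub>P (wedge S_star (\<lambda>c y h. (H\<^sub>0 y - mat (lam y) ** \<pi>\<^sub>0 y) ** S c y h)) x"
    unfolding F S term_eq
    by (simp add: matrix_mult.sum_right matrix_mult.scaleR_right scaleR_diff_right sum_subtractf)
  finally show "\<pi>\<^sub>0 x ** matrix_bracket A \<Pi>\<^sub>P \<pi>\<^sub>0 (\<lambda>y. H\<^sub>0 y - mat (lam y)) x ** \<pi>\<^sub>0 x = \<dots>"
    by (simp add: P_def K_def[abs_def])
qed

end
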